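(* Let $V$ be a topological vector space preordered with respect to a closed convex cone $V_+\subseteq V$, with $u\in V_+$ such that $[-u,+u]$ is a neighbourhood of zero. Let all random variables be $V$-valued, compactly supported and Radon. For random variables $X$ and $Y$ with i.i.d. copies $(X_i)_{i\in\mathbb{N}}$ of $X$ and $(Y_i)_{i\in\mathbb{N}}$ of $Y$, we have $$\sup_{\varepsilon>0}\ \overline{\lim}_{n\to\infty}\ \sup_{C}\ \frac1n\log\frac{\mathbf{P}\left[\frac1n\sum_{i=1}^n X_i\in C\right]}{\mathbf{P}\left[\frac1n\sum_{i=1}^n Y_i+\varepsilon u\in C\right]} \;=\; \sup_{t\in V^*_+}\ \log\frac{\mathbb{E}[e^{\langle t,X\rangle}]}{\mathbb{E}[e^{\langle t,Y\rangle}]},$$ where $C$ ranges over all closed upsets in $V$, and the statement holds in two versions: with $\overline{\lim}_{n\to\infty}$ standing for $\liminf_{n\to\infty}$, and with it standing for $\limsup_{n\to\infty}$.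
   Context: $V$ is a real topological vector space, with Hausdorff topology by convention. The preorder on $V$ is $a\le b$ iff $b-a\in V_+$, and $[a,b]=\{x: a\le x\le b\}$. A subset $C\subseteq V$ is an upset if $x\in C$ and $x\le y$ imply $y\in C$. $V^*_+$ denotes the set of monotone (order-preserving) group homomorphisms $t:V\to\mathbb{R}$, and $\langle t,x\rangle:=t(x)$. A random variable is Radon if its distribution is a Radon measure (a finite inner regular Borel measure), and compactly supported if the support of its distribution (the smallest closed set of full measure) is compact. The distribution of a sum of independent variables is the convolution of their distributions, i.e. the pushforward of the Radon product measure along addition. Both sides take values in the extended reals. The fraction on the left-hand side is understood to be $\infty$ if its denominator vanishes and its numerator does not, and $\frac00:=0$ (so that those $C$ for which both vanish do not contribute to the supremum); $\log0=-\infty$ and $\log\infty=\infty$. *)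

theory Defs
  imports "HOL-Probability.Probability"
begin

class real_tvs = real_vector + topological_ab_group_add + t2_space +
  assumes tendsto_scaleR_Pair: "LIM x (nhds r \<times>\<^sub>F nhds a). fst x *\<^sub>R snd x :> nhds (r *\<^sub>R a)"

definition cone_le :: "'v::real_vector set \<Rightarrow> 'v \<Rightarrow> 'v \<Rightarrow> bool" where
  "cone_le V\<^sub>p a b \<longleftrightarrow> b - a \<in> V\<^sub>p"

definition cone_interval :: "'v::real_vector set \<Rightarrow> 'v \<Rightarrow> 'v \<Rightarrow> 'v set" where
  "cone_interval V\<^sub>p a b = {x. cone_le V\<^sub>p a x \<and> cone_le V\<^sub>p x b}"

definition upset :: "'v::real_vector set \<Rightarrow> 'v set \<Rightarrow> bool" where
  "upset V\<^sub>p C \<longleftrightarrow> (\<forall>x y. x \<in> C \<longrightarrow> cone_le V\<^sub>p x y \<longrightarrow> y \<in> C)"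

definition monotone_homs :: "'v::real_vector set \<Rightarrow> ('v \<Rightarrow> real) set" where
  "monotone_homs V\<^sub>p = {t. Modules.additive t \<and> monotone (cone_le V\<^sub>p) (\<le>) t}"

text \<open>The Radon notions below are meant for Hausdorff spaces, where compact sets are Borel. The sort
  is merely \<open>topological_space\<close> because they are also applied to the function type
  \<open>nat \<Rightarrow> 'v\<close> with its product topology.\<close>

definition radon_measure :: "'a::topological_space measure \<Rightarrow> bool" where
  "radon_measure \<mu> \<longleftrightarrow> finite_measure \<mu> \<and> sets \<mu> = sets borel \<and>
     (\<forall>A\<in>sets borel. emeasure \<mu> A = (SUP K\<in>{K. compact K \<and> K \<subseteq> A}. emeasure \<mu> K))"

definition radon_rv :: "'w measure \<Rightarrow> ('w \<Rightarrow> 'a::topological_space) \<Rightarrow> bool" where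
  "radon_rv M X \<longleftrightarrow> X \<in> borel_measurable M \<and> radon_measure (distr M borel X)"

text \<open>For a Radon measure the intersection below itself has full measure, so it is the smallest
  closed set of full measure.\<close>

definition measure_support :: "'a::topological_space measure \<Rightarrow> 'a set" where
  "measure_support \<mu> = \<Inter> {F. closed F \<and> emeasure \<mu> F = emeasure \<mu> (space \<mu>)}"

definition compactly_supported :: "'w measure \<Rightarrow> ('w \<Rightarrow> 'a::topological_space) \<Rightarrow> bool" where
  "compactly_supported M X \<longleftrightarrow> compact (measure_support (distr M borel X))"

text \<open>If \<open>'v\<close> is not second countable, independence determines the joint law of a finite family only
  on the product \<open>\<sigma>\<close>-algebra, which can be smaller than the Borel \<open>\<sigma>\<close>-algebra of the product
  space and need not make addition measurable. The last conjunct says that the joint law is the Radon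
  measure extending the product of the marginals, i.e. the Radon product measure; the law of a partial
  sum is then its pushforward along addition, the convolution of the marginals. Tuples indexed by
  \<open>I\<close> are encoded as functions \<open>nat \<Rightarrow> 'v\<close> that are constantly \<open>undefined\<close> outside \<open>I\<close>; these form a
  closed subspace homeomorphic to the \<open>I\<close>-fold power of \<open>'v\<close>.\<close>

definition iid_copies :: "'w measure \<Rightarrow> ('w \<Rightarrow> 'v::topological_space) \<Rightarrow> (nat \<Rightarrow> 'w \<Rightarrow> 'v) \<Rightarrow> bool" where
  "iid_copies M X Xs \<longleftrightarrow>
     prob_space.indep_vars M (\<lambda>_. borel) Xs UNIV \<and>
     (\<forall>i. distr M borel (Xs i) = distr M borel X) \<and>
     (\<forall>I. finite I \<longrightarrow> radon_rv M (\<lambda>\<omega>. \<lambda>i\<in>I. Xs i \<omega>))"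

text \<open>Extended logarithm. Division on \<^typ>\<open>ereal\<close> already satisfies \<open>x / 0 = \<infinity>\<close> for \<open>x > 0\<close> and
  \<open>0 / 0 = 0\<close>.\<close>

definition ereal_ln :: "ereal \<Rightarrow> ereal" where
  "ereal_ln x = (if x \<le> 0 then -\<infinity> else if x = \<infinity> then \<infinity> else ereal (ln (real_of_ereal x)))"

definition log_ratio :: "real \<Rightarrow> real \<Rightarrow> ereal" where
  "log_ratio p q = ereal_ln (ereal p / ereal q)"

end

theory Submission
  imports Defs "HOL-Real_Asymp.Real_Asymp"
begin

text \<open>
  The bound from below uses the half-spaces \<open>{x. a \<le> t x}\<close>: the Chernoff bound for \<open>Y\<close> and Cramer's
  lower bound for \<open>X\<close> at the mean \<open>a\<close> of the \<open>exp t\<close>-tilted law of \<open>t X\<close> have rates differing by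
  the logarithmic ratio of the moment generating functions.

  For the bound from above, compactness makes all averages of \<open>X\<close> lie within \<open>\<delta> u\<close> of one finite set
  \<open>Z\<close>, so that it suffices to compare the probabilities of the orthants \<open>{x. z \<le> x}\<close> for \<open>z \<in> Z\<close>.
  For \<open>X\<close> these are bounded by Chernoff's inequality. For \<open>Y\<close> one needs Cramer's lower bound with
  rate \<open>inf\<^sub>t ln E[exp (t Y)] - t z\<close>. It is proved for a finitely supported approximation of \<open>Y\<close>:
  the triples \<open>(x, b, n)\<close> for which the sum of \<open>n\<close> copies dominates \<open>x\<close> with probability at least
  \<open>exp b\<close> form a semigroup, and if the lower bound failed, a Hahn--Banach functional separating this
  semigroup from the positive cone would be a monotone \<open>t\<close> whose moment generating function is too
  small. Passing to a finitely supported law also removes all measurability problems of sums in a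
  non-separable space.
\<close>

section \<open>Additive minorants of sublinear functionals\<close>

text \<open>The parameter \<epsilon> pays for every loss of precision in the order: rounding the
  sample, replacing a closed upset by orthants at net points, and the slack in Cramer's bound each
  shift the target by a multiple of \<open>u\<close>. Losses in probability have the form
  \<open>exp (n * \<delta>)\<close> and become arbitrarily small after taking logarithms and
  dividing by \<open>n\<close>. Both must be uniform in \<open>C\<close>, which may vary with
  \<open>n\<close>.

  The delicate point is the upper estimate. Chernoff's bound for \<open>X\<close> on an orthant is
  an infimum over all \<open>t\<close>, whereas the right-hand side compares the two laws for one
  \<open>t\<close> at a time; so the infimum must be shown to be the actual rate for
  \<open>Y\<close>, which is a duality statement. Separation provides it without any topology on the
  set of functionals. The functional obtained is only additive, which is all that
  \<open>monotone_homs\<close> asks for. The contradiction comes from the fact that, for finitely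
  many atoms, powers of the moment generating function are controlled by tail weights up to a
  polynomial factor.\<close>

definition nat_sublinear :: "('f::real_vector \<Rightarrow> real) \<Rightarrow> bool" where
  "nat_sublinear p \<longleftrightarrow> (\<forall>x y. p (x + y) \<le> p x + p y) \<and> (\<forall>(m::nat) x. p (real m *\<^sub>R x) = real m * p x)"

lemma nat_sublinear_add: "nat_sublinear p \<Longrightarrow> p (x + y) \<le> p x + p y"
  and nat_sublinear_scale: "nat_sublinear p \<Longrightarrow> p (real m *\<^sub>R x) = real m * p x"
  by (auto simp: nat_sublinear_def)

lemma nat_sublinear_zero: "nat_sublinear p \<Longrightarrow> p 0 = 0"
  using nat_sublinear_scale[of p 0 0] by simp

lemma nat_sublinear_minus: "nat_sublinear p \<Longrightarrow> - p (- x) \<le> p x"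
  using nat_sublinear_add[of p x "- x"] by (simp add: nat_sublinear_zero)

text \<open>Zorn's lemma for the reversed pointwise order. Infima of nonempty chains are real-valued
  since every member satisfies \<open>q x \<ge> - q (- x) \<ge> - p (- x)\<close>.\<close>

lemma exists_minimal_nat_sublinear:
  fixes p :: "'f::real_vector \<Rightarrow> real"
  assumes "nat_sublinear p"
  shows "\<exists>q. nat_sublinear q \<and> (\<forall>x. q x \<le> p x) \<and>
           (\<forall>q'. nat_sublinear q' \<longrightarrow> (\<forall>x. q' x \<le> q x) \<longrightarrow> q' = q)"
proof -
  define A where "A = {q. nat_sublinear q \<and> (\<forall>x. q x \<le> p x)}"
  define P :: "('f \<Rightarrow> real) \<Rightarrow> ('f \<Rightarrow> real) \<Rightarrow> bool" where "P = (\<lambda>a b. \<forall>x. b x \<le> a x)"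
  have "\<exists>m\<in>A. \<forall>a\<in>A. P m a \<longrightarrow> a = m"
  proof (rule predicate_Zorn)
    show "partial_order_on A (relation_of P A)"
    proof (rule partial_order_on_relation_ofI)
      show "P a a" for a by (simp add: P_def)
      show "P a c" if "P a b" "P b c" for a b c
        using that by (auto simp: P_def intro: order_trans)
      show "a = b" if "P a b" "P b a" for a b
        using that by (auto simp: P_def intro!: ext antisym)
    qed
  next
    fix C assume C: "C \<in> Chains (relation_of P A)"
    have sub: "q \<in> A" if "q \<in> C" for q
      using C that unfolding Chains_def relation_of_def by auto
    have tot: "P a b \<or> P b a" if "a \<in> C" "b \<in> C" for a b
      using C that unfolding Chains_def relation_of_def by auto
    show "\<exists>l\<in>A. \<forall>a\<in>C. P a l"
    proof (cases "C = {}")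
      case True
      then show ?thesis using assms by (auto simp: A_def)
    next
      case False
      define l where "l x = (INF q\<in>C. q x)" for x
      have bdd: "bdd_below ((\<lambda>q. q x) ` C)" for x
      proof (rule bdd_belowI2)
        fix q assume "q \<in> C"
        then have q: "nat_sublinear q" "q (- x) \<le> p (- x)" using sub by (auto simp: A_def)
        show "- p (- x) \<le> q x" using nat_sublinear_minus[OF q(1), of x] q(2) by linarith
      qed
      have l_le: "l x \<le> q x" if "q \<in> C" for q x
        unfolding l_def by (rule cINF_lower[OF bdd that])
      have l_ge: "c \<le> l x" if "\<And>q. q \<in> C \<Longrightarrow> c \<le> q x" for c x
        unfolding l_def by (rule cINF_greatest[OF False that])
      have "l (x + y) \<le> l x + l y" for x y
      proof -
        have "l (x + y) - q' y \<le> l x" if "q' \<in> C" for q'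
        proof (rule l_ge)
          fix q assume "q \<in> C"
          \<comment> \<open>Of the members chosen at \<open>x\<close> and at \<open>y\<close>, the
            smaller one serves at both points; subadditivity of the infimum rests on this use of
            totality.\<close>
          have "\<exists>q''\<in>C. q'' x \<le> q x \<and> q'' y \<le> q' y"
            using tot[OF \<open>q \<in> C\<close> that] \<open>q \<in> C\<close> that unfolding P_def by (meson order_refl)
          then obtain q'' where q'': "q'' \<in> C" "q'' x \<le> q x" "q'' y \<le> q' y" by blast
          have "l (x + y) \<le> q'' x + q'' y"
            using l_le[OF q''(1), of "x + y"] sub[OF q''(1)] nat_sublinear_add[of q'' x y]
            by (auto simp: A_def)
          then show "l (x + y) - q' y \<le> q x" using q'' by linarith
        qed
        then have "l (x + y) - l x \<le> l y" by (intro l_ge) (simp add: algebra_simps)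
        then show ?thesis by linarith
      qed
      moreover have "l (real m *\<^sub>R x) = real m * l x" for m x
      proof (rule antisym)
        have q_scale: "q (real m *\<^sub>R x) = real m * q x" if "q \<in> C" for q
          using sub[OF that] by (auto simp: A_def nat_sublinear_scale)
        show "real m * l x \<le> l (real m *\<^sub>R x)"
          by (rule l_ge) (simp add: q_scale l_le mult_left_mono)
        show "l (real m *\<^sub>R x) \<le> real m * l x"
        proof (cases "m = 0")
          case True
          obtain q where "q \<in> C" using False by auto
          then show ?thesis using True l_le[of q 0] sub[of q] by (auto simp: A_def nat_sublinear_zero)
        next
          case m: False
          have "l (real m *\<^sub>R x) / real m \<le> l x"
          proof (rule l_ge)
            fix q assume "q \<in> C"
            then show "l (real m *\<^sub>R x) / real m \<le> q x"
              using l_le[of q "real m *\<^sub>R x"] q_scale[of q] m by (simp add: field_simps)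
          qed
          then show ?thesis using m by (simp add: field_simps)
        qed
      qed
      moreover have "l x \<le> p x" for x
      proof -
        obtain q where "q \<in> C" using False by auto
        then show ?thesis using l_le[of q x] sub[of q] by (auto simp: A_def intro: order_trans)
      qed
      ultimately have "l \<in> A" by (auto simp: A_def nat_sublinear_def)
      then show ?thesis using l_le by (auto simp: P_def)
    qed
  qed
  then obtain q where q: "q \<in> A" "\<And>a. a \<in> A \<Longrightarrow> P q a \<Longrightarrow> a = q" by blast
  have "q' = q" if "nat_sublinear q'" "\<forall>x. q' x \<le> q x" for q'
    using that q(1) by (intro q(2)) (auto simp: A_def P_def intro: order_trans)
  then show ?thesis using q(1) by (auto simp: A_def)
qed

text \<open>For fixed \<open>v\<close>, the functional \<open>x \<mapsto> inf\<^sub>k q (x + k v) - k q v\<close> is again sublinear and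
  at most \<open>q\<close>; if \<open>q\<close> is minimal it therefore equals \<open>q\<close>, which gives superadditivity.\<close>

lemma minimal_nat_sublinear_additive:
  fixes q :: "'f::real_vector \<Rightarrow> real"
  assumes q: "nat_sublinear q"
    and minimal: "\<And>q'. nat_sublinear q' \<Longrightarrow> (\<And>x. q' x \<le> q x) \<Longrightarrow> q' = q"
  shows "Modules.additive q"
proof (rule additive.intro)
  fix x v :: 'f
  define d where "d y k = q (y + real k *\<^sub>R v) - real k * q v" for y k
  define r where "r y = (INF k. d y k)" for y
  have bdd: "bdd_below (range (d y))" for y
  proof (rule bdd_belowI2)
    fix k
    have "q (real k *\<^sub>R v) \<le> q (y + real k *\<^sub>R v) + q (- y)"
      using nat_sublinear_add[OF q, of "y + real k *\<^sub>R v" "- y"] by simp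
    then show "- q (- y) \<le> d y k" by (simp add: d_def nat_sublinear_scale[OF q])
  qed
  have r_le: "r y \<le> d y k" for y k
    unfolding r_def by (rule cINF_lower[OF bdd]) simp
  have r_ge: "c \<le> r y" if "\<And>k. c \<le> d y k" for c y
    unfolding r_def by (rule cINF_greatest) (use that in auto)
  have r_add: "r (y + z) \<le> r y + r z" for y z
  proof -
    have dd: "r (y + z) \<le> d y k + d z l" for k l
      using r_le[of "y + z" "k + l"] nat_sublinear_add[OF q, of "y + real k *\<^sub>R v" "z + real l *\<^sub>R v"]
      by (simp add: d_def algebra_simps)
    have "r (y + z) - d z l \<le> r y" for l by (rule r_ge) (use dd in \<open>simp add: algebra_simps\<close>)
    then have "r (y + z) - r y \<le> r z" by (intro r_ge) (simp add: algebra_simps)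
    then show ?thesis by linarith
  qed
  have d_mult: "d (real m *\<^sub>R y) (m * k) = real m * d y k" for m y k
    using nat_sublinear_scale[OF q, of m "y + real k *\<^sub>R v"] by (simp add: d_def algebra_simps)
  have d_anti: "d y (k + j) \<le> d y k" for y k j
    using nat_sublinear_add[OF q, of "y + real k *\<^sub>R v" "real j *\<^sub>R v"] nat_sublinear_scale[OF q, of j v]
    by (simp add: d_def algebra_simps)
  have r_scale: "r (real m *\<^sub>R y) = real m * r y" for m y
  proof (cases "m = 0")
    case True
    have "d 0 k = 0" for k by (simp add: d_def nat_sublinear_scale[OF q])
    then show ?thesis using True by (simp add: r_def)
  next
    case False
    show ?thesis
    proof (rule antisym)
      have "r (real m *\<^sub>R y) / real m \<le> r y"
        using False r_le[of "real m *\<^sub>R y"] by (intro r_ge) (simp add: field_simps flip: d_mult)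
      then show "r (real m *\<^sub>R y) \<le> real m * r y" using False by (simp add: field_simps)
      show "real m * r y \<le> r (real m *\<^sub>R y)"
      proof (rule r_ge)
        fix k
        \<comment> \<open>\<open>d_mult\<close> only reaches indices divisible by \<open>m\<close>.
          Since \<open>d\<close> decreases in the index, the value at \<open>k\<close> is bounded
          below by the one at \<open>m * k \<ge> k\<close>.\<close>
        have "k + (m * k - k) = m * k" using False by (cases m) auto
        then have "real m * d y k \<le> d (real m *\<^sub>R y) k"
          using d_anti[of "real m *\<^sub>R y" k "m * k - k"] by (simp add: d_mult)
        then show "real m * r y \<le> d (real m *\<^sub>R y) k"
          using r_le[of y k] by (meson mult_left_mono of_nat_0_le_iff order_trans)
      qed
    qed
  qed
  have "r = q"
  proof (rule minimal)
    show "nat_sublinear r" using r_add r_scale by (simp add: nat_sublinear_def)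
    show "r y \<le> q y" for y using r_le[of y 0] by (simp add: d_def)
  qed
  then have "q x \<le> d x 1" using r_le[of x 1] by simp
  then show "q (x + v) = q x + q v"
    using nat_sublinear_add[OF q, of x v] by (simp add: d_def)
qed

lemma nat_sublinear_additive_minorant:
  assumes "nat_sublinear p"
  obtains l where "Modules.additive l" "\<And>x. l x \<le> p x"
  using exists_minimal_nat_sublinear[OF assms] minimal_nat_sublinear_additive by metis

section \<open>Separation of a semigroup from a convex cone\<close>

lemma additive_scale_nat:
  fixes l :: "'f::real_vector \<Rightarrow> real"
  assumes "Modules.additive l"
  shows "l (real k *\<^sub>R x) = real k * l x"
  by (induction k) (simp_all add: additive.zero[OF assms] additive.add[OF assms] algebra_simps)

text \<open>The functional is an additive minorant of
  \<open>p v = inf {\<lambda>. k v \<le> k \<lambda> f + \<sigma> for some k \<ge> 1 and \<sigma> \<in> T}\<close>, the gauge of \<open>f\<close> modulo \<open>T\<close>; working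
  with natural multiples only makes \<open>T\<close> enter as a semigroup rather than a cone.\<close>

lemma positive_functional_nonpos_on_semigroup:
  fixes P T :: "'f::real_vector set" and f :: 'f
  assumes P: "convex_cone P" and unit: "\<And>x. \<exists>c. c *\<^sub>R f - x \<in> P"
    and T0: "0 \<in> T" and Tadd: "\<And>x y. x \<in> T \<Longrightarrow> y \<in> T \<Longrightarrow> x + y \<in> T"
    and T: "\<And>x c. x \<in> T \<Longrightarrow> c > 0 \<Longrightarrow> x - c *\<^sub>R f \<notin> P"
  obtains l where "Modules.additive l" "\<And>x. x \<in> P \<Longrightarrow> l x \<ge> 0" "\<And>c. l (c *\<^sub>R f) = c"
    "\<And>x. x \<in> T \<Longrightarrow> l x \<le> 0"
proof -
  note Padd = convex_cone_add[OF P] and Pscale = convex_cone_scaleR[OF P]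
  have P0: "0 \<in> P" using P by (simp add: convex_cone_iff)
  have Tscale: "real k *\<^sub>R x \<in> T" if "x \<in> T" for k x
    by (induction k) (simp_all add: T0 Tadd[OF that] algebra_simps)
  define F where "F v = {c. \<exists>k\<ge>1. \<exists>x\<in>T. (real k * c) *\<^sub>R f + x - real k *\<^sub>R v \<in> P}" for v
  define p where "p v = Inf (F v)" for v
  have F_I: "c \<in> F v" if "k \<ge> 1" "x \<in> T" "(real k * c) *\<^sub>R f + x - real k *\<^sub>R v \<in> P" for c v k x
    using that by (auto simp: F_def)
  have F_ne: "F v \<noteq> {}" for v
    using unit[of v] F_I[of 1 0 _ v] T0 by auto
  \<comment> \<open>Finiteness of the gauge is where separation enters: a value below
    \<open>- b\<close> would put an element of \<open>T\<close> minus a positive multiple of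
    \<open>f\<close> into \<open>P\<close>.\<close>
  have F_bdd: "\<exists>b. \<forall>c\<in>F v. b \<le> c" for v
  proof -
    obtain b where b: "b *\<^sub>R f + v \<in> P" using unit[of "- v"] by auto
    have "- b \<le> c" if "c \<in> F v" for c
    proof (rule ccontr)
      assume "\<not> - b \<le> c"
      then have neg: "- (c + b) > 0" by simp
      from that obtain k x where kx: "k \<ge> 1" "x \<in> T" "(real k * c) *\<^sub>R f + x - real k *\<^sub>R v \<in> P"
        by (auto simp: F_def)
      have "((real k * c) *\<^sub>R f + x - real k *\<^sub>R v) + real k *\<^sub>R (b *\<^sub>R f + v) \<in> P"
        by (rule Padd[OF kx(3) Pscale[OF _ b]]) simp
      then have "x - (real k * (- (c + b))) *\<^sub>R f \<in> P" by (simp add: algebra_simps)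
      moreover have "real k * (- (c + b)) > 0" using neg kx(1) by (intro mult_pos_pos) auto
      ultimately show False using T kx(2) by blast
    qed
    then show ?thesis by blast
  qed
  have p_le: "p v \<le> c" if "c \<in> F v" for v c
    unfolding p_def by (rule cInf_lower[OF that]) (use F_bdd in \<open>auto simp: bdd_below_def\<close>)
  have p_ge: "b \<le> p v" if "\<And>c. c \<in> F v \<Longrightarrow> b \<le> c" for v b
    unfolding p_def by (rule cInf_greatest[OF F_ne that])
  have p_add: "p (v + w) \<le> p v + p w" for v w
  proof -
    have "p (v + w) \<le> c + c'" if c: "c \<in> F v" and c': "c' \<in> F w" for c c'
    proof (rule p_le)
      from c obtain k x where kx: "k \<ge> 1" "x \<in> T" "(real k * c) *\<^sub>R f + x - real k *\<^sub>R v \<in> P"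
        by (auto simp: F_def)
      from c' obtain j y where jy: "j \<ge> 1" "y \<in> T" "(real j * c') *\<^sub>R f + y - real j *\<^sub>R w \<in> P"
        by (auto simp: F_def)
      \<comment> \<open>Cross-multiplication gives both inequalities the common multiple
        \<open>j * k\<close> and keeps the \<open>T\<close>-parts in the semigroup.\<close>
      have "real j *\<^sub>R ((real k * c) *\<^sub>R f + x - real k *\<^sub>R v) + real k *\<^sub>R ((real j * c') *\<^sub>R f + y - real j *\<^sub>R w) \<in> P"
        by (intro Padd Pscale kx jy) auto
      then have "(real (j * k) * (c + c')) *\<^sub>R f + (real j *\<^sub>R x + real k *\<^sub>R y) - real (j * k) *\<^sub>R (v + w) \<in> P"
        by (simp add: algebra_simps)
      then show "c + c' \<in> F (v + w)"
        using kx jy by (intro F_I[of "j * k" "real j *\<^sub>R x + real k *\<^sub>R y"] Tadd Tscale) auto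
    qed
    then have "p (v + w) - c' \<le> p v" if "c' \<in> F w" for c'
      using that by (intro p_ge) (simp add: algebra_simps)
    then have "p (v + w) - p v \<le> p w" by (intro p_ge) (simp add: algebra_simps)
    then show ?thesis by linarith
  qed
  have p_scale: "p (real m *\<^sub>R v) = real m * p v" for m v
  proof (cases "m = 0")
    case True
    have "p 0 \<le> 0" by (rule p_le, rule F_I[of 1 0]) (simp_all add: T0 P0)
    moreover have "0 \<le> p 0" using p_add[of 0 0] by simp
    ultimately show ?thesis using True by simp
  next
    case m: False
    show ?thesis
    proof (rule antisym)
      have "p (real m *\<^sub>R v) / real m \<le> p v"
      proof (rule p_ge)
        fix c assume "c \<in> F v"
        then obtain k x where kx: "k \<ge> 1" "x \<in> T" "(real k * c) *\<^sub>R f + x - real k *\<^sub>R v \<in> P"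
          by (auto simp: F_def)
        have "real m *\<^sub>R ((real k * c) *\<^sub>R f + x - real k *\<^sub>R v) \<in> P"
          by (intro Pscale kx) auto
        then have "p (real m *\<^sub>R v) \<le> real m * c"
          by (intro p_le F_I[OF kx(1) Tscale[OF kx(2), of m]]) (simp add: algebra_simps)
        then show "p (real m *\<^sub>R v) / real m \<le> c" using m by (simp add: field_simps)
      qed
      then show "p (real m *\<^sub>R v) \<le> real m * p v" using m by (simp add: field_simps)
      show "real m * p v \<le> p (real m *\<^sub>R v)"
      proof (rule p_ge)
        fix c assume "c \<in> F (real m *\<^sub>R v)"
        then obtain k x where kx: "k \<ge> 1" "x \<in> T" "(real k * c) *\<^sub>R f + x - real k *\<^sub>R (real m *\<^sub>R v) \<in> P"
          by (auto simp: F_def)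
        have "p v \<le> c / real m"
          by (intro p_le F_I[OF _ kx(2), of "k * m"]) (use kx m in auto)
        then show "real m * p v \<le> c" using m by (simp add: field_simps)
      qed
    qed
  qed
  obtain l where l: "Modules.additive l" "\<And>x. l x \<le> p x"
    using nat_sublinear_additive_minorant[of p] p_add p_scale by (auto simp: nat_sublinear_def)
  \<comment> \<open>Multiple 1 in the definition of \<open>F\<close> is enough to read off
    positivity, the normalisation at \<open>f\<close> and the sign on \<open>T\<close>.\<close>
  have l_le: "l x \<le> c" if "c *\<^sub>R f + y - x \<in> P" "y \<in> T" for x y c
    using F_I[of 1 y c x] that l(2)[of x] p_le[of c x] by auto
  show ?thesis
  proof (rule that[OF l(1)])
    show "l x \<ge> 0" if "x \<in> P" for x
      using l_le[of 0 0 "- x"] that T0 by (simp add: additive.minus[OF l(1)])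
    show "l (c *\<^sub>R f) = c" for c
      using l_le[of c 0 "c *\<^sub>R f"] l_le[of "- c" 0 "- c *\<^sub>R f"] T0 P0
      by (simp add: additive.minus[OF l(1)])
    show "l x \<le> 0" if "x \<in> T" for x
      using l_le[of 0 x x] that P0 by simp
  qed
qed

section \<open>Tail weights of finitely supported laws\<close>

text \<open>Cauchy's equation. Monotonicity squeezes \<open>g (n * x)\<close> between the values at
  neighbouring integers, so the error at \<open>x\<close>, multiplied by any \<open>n\<close>, stays
  below \<open>g 1\<close>.\<close>

lemma additive_mono_real_linear:
  fixes g :: "real \<Rightarrow> real"
  assumes g: "Modules.additive g" and mono: "mono g"
  shows "g x = x * g 1"
proof -
  have nat: "g (real k * y) = real k * g y" for k y
    using additive_scale_nat[OF g, of k y] by simp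
  have int: "g (of_int k) = of_int k * g 1" for k
  proof (cases "k \<ge> 0")
    case True
    then show ?thesis using nat[of "nat k" 1] by simp
  next
    case False
    then show ?thesis using nat[of "nat (- k)" 1] additive.minus[OF g, of "of_int k"] by simp
  qed
  have g1: "g 1 \<ge> 0" using monoD[OF mono, of 0 1] by (simp add: additive.zero[OF g])
  have bound: "real n * \<bar>g x - x * g 1\<bar> \<le> g 1" for n
  proof -
    define k where "k = \<lfloor>real n * x\<rfloor>"
    have k: "of_int k \<le> real n * x" "real n * x \<le> of_int (k + 1)"
      unfolding k_def by linarith+
    have "of_int k * g 1 \<le> real n * g x" "real n * g x \<le> of_int (k + 1) * g 1"
      using monoD[OF mono k(1)] monoD[OF mono k(2)] int nat[of n x] by metis+
    moreover have "of_int k * g 1 \<le> (real n * x) * g 1" "(real n * x) * g 1 \<le> of_int (k + 1) * g 1"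
      using k g1 by (auto intro!: mult_right_mono)
    ultimately have "\<bar>real n * g x - (real n * x) * g 1\<bar> \<le> g 1"
      by (simp add: algebra_simps abs_le_iff)
    then show ?thesis by (simp add: abs_mult_pos' algebra_simps)
  qed
  show ?thesis
  proof (rule ccontr)
    assume "g x \<noteq> x * g 1"
    then obtain n where "g 1 < real n * \<bar>g x - x * g 1\<bar>"
      using reals_Archimedean3[of "\<bar>g x - x * g 1\<bar>"] by auto
    with bound[of n] show False by linarith
  qed
qed

text \<open>\<open>tail_weight P A w n x\<close> is the probability that the sum of \<open>n\<close> independent draws from the law
  \<open>w\<close> on \<open>A\<close> is at least \<open>x\<close> in the order with positive cone \<open>P\<close>; \<open>point_weight\<close> is the probability
  that it equals \<open>x\<close>.\<close>

primrec tail_weight :: "'v::real_vector set \<Rightarrow> 'v set \<Rightarrow> ('v \<Rightarrow> real) \<Rightarrow> nat \<Rightarrow> 'v \<Rightarrow> real" where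
  "tail_weight P A w 0 x = (if - x \<in> P then 1 else 0)"
| "tail_weight P A w (Suc n) x = (\<Sum>a\<in>A. w a * tail_weight P A w n (x - a))"

primrec point_weight :: "'v::real_vector set \<Rightarrow> ('v \<Rightarrow> real) \<Rightarrow> nat \<Rightarrow> 'v \<Rightarrow> real" where
  "point_weight A w 0 x = (if x = 0 then 1 else 0)"
| "point_weight A w (Suc n) x = (\<Sum>a\<in>A. w a * point_weight A w n (x - a))"

text \<open>A superset of the values of a sum of \<open>n\<close> draws, indexed by multiplicities.
  Letting each multiplicity range over \<open>{..n}\<close>, instead of fixing their total, keeps
  the size polynomial in \<open>n\<close> and makes one more draw a change of a single
  coordinate.\<close>

definition count_sums :: "'v::real_vector set \<Rightarrow> nat \<Rightarrow> 'v set" where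
  "count_sums A n = (\<lambda>c. \<Sum>a\<in>A. real (c a) *\<^sub>R a) ` (A \<rightarrow>\<^sub>E {..n})"

lemma finite_count_sums: "finite A \<Longrightarrow> finite (count_sums A n)"
  unfolding count_sums_def by (intro finite_imageI finite_PiE) auto

lemma card_count_sums: "finite A \<Longrightarrow> card (count_sums A n) \<le> (n + 1) ^ card A"
  unfolding count_sums_def
  by (rule order_trans[OF card_image_le]) (auto simp: card_PiE intro: finite_PiE)

lemma count_sums_add:
  assumes A: "finite A" and x: "x \<in> count_sums A n" and a: "a \<in> A"
  shows "x + a \<in> count_sums A (Suc n)"
proof -
  from x obtain c where c: "c \<in> A \<rightarrow>\<^sub>E {..n}" "x = (\<Sum>a\<in>A. real (c a) *\<^sub>R a)"
    by (auto simp: count_sums_def)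
  define c' where "c' = c(a := Suc (c a))"
  have "x = real (c a) *\<^sub>R a + (\<Sum>b\<in>A - {a}. real (c b) *\<^sub>R b)"
    using sum.remove[OF A a] c(2) by simp
  moreover have "(\<Sum>b\<in>A. real (c' b) *\<^sub>R b) = real (Suc (c a)) *\<^sub>R a + (\<Sum>b\<in>A - {a}. real (c b) *\<^sub>R b)"
    using sum.remove[OF A a, of "\<lambda>b. real (c' b) *\<^sub>R b"] by (simp add: c'_def)
  ultimately have "x + a = (\<Sum>b\<in>A. real (c' b) *\<^sub>R b)" by (simp add: algebra_simps)
  moreover have "c' \<in> A \<rightarrow>\<^sub>E {..Suc n}"
    using c(1) a by (fastforce simp: c'_def PiE_def Pi_def extensional_def le_Suc_eq)
  ultimately show ?thesis by (auto simp: count_sums_def)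
qed

locale finite_weights =
  fixes A :: "'v::real_vector set" and w :: "'v \<Rightarrow> real"
  assumes finite_A: "finite A" and w_nonneg: "\<And>a. w a \<ge> 0" and w_sum: "sum w A = 1"
begin

lemma point_weight_nonneg: "point_weight A w n x \<ge> 0"
  by (induction n arbitrary: x) (auto intro!: sum_nonneg mult_nonneg_nonneg w_nonneg)

lemma tail_weight_nonneg: "tail_weight P A w n x \<ge> 0"
  by (induction n arbitrary: x) (auto intro!: sum_nonneg mult_nonneg_nonneg w_nonneg)

lemma tail_weight_le_1: "tail_weight P A w n x \<le> 1"
proof (induction n arbitrary: x)
  case (Suc n)
  have "tail_weight P A w (Suc n) x \<le> (\<Sum>a\<in>A. w a * 1)"
    unfolding tail_weight.simps by (intro sum_mono mult_left_mono Suc w_nonneg)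
  then show ?case by (simp add: w_sum)
qed simp

lemma point_le_tail_weight: "0 \<in> P \<Longrightarrow> point_weight A w n x \<le> tail_weight P A w n x"
  by (induction n arbitrary: x) (auto intro!: sum_mono mult_left_mono w_nonneg)

text \<open>Expands the power one draw at a time and groups by the value of the sum. The translate
  of one value set by a draw lies in the next value set, and the added terms are nonnegative, hence
  the inequality.\<close>

lemma mgf_power_le_sum_point_weight:
  assumes t: "Modules.additive t"
  shows "(\<Sum>a\<in>A. w a * exp (t a)) ^ n \<le> (\<Sum>x\<in>count_sums A n. point_weight A w n x * exp (t x))"
proof (induction n)
  case 0
  have "count_sums A 0 = {0}"
    using finite_A by (auto simp: count_sums_def image_iff PiE_iff Bex_def
      intro!: exI[of _ "\<lambda>a\<in>A. 0"] sum.neutral)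
  then show ?case by (simp add: additive.zero[OF t])
next
  case (Suc n)
  let ?p = "point_weight A w n" and ?S = "count_sums A n" and ?S' = "count_sums A (Suc n)"
  have le: "(\<Sum>x\<in>?S. ?p x * exp (t x)) \<le> (\<Sum>x\<in>?S'. ?p (x - a) * exp (t (x - a)))" if "a \<in> A" for a
  proof -
    have "(\<Sum>x\<in>?S. ?p x * exp (t x)) = (\<Sum>x\<in>(\<lambda>x. x + a) ` ?S. ?p (x - a) * exp (t (x - a)))"
      by (subst sum.reindex) (auto simp: inj_on_def)
    also have "\<dots> \<le> (\<Sum>x\<in>?S'. ?p (x - a) * exp (t (x - a)))"
      using count_sums_add[OF finite_A _ that] finite_count_sums[OF finite_A]
      by (intro sum_mono2) (auto simp: point_weight_nonneg)
    finally show ?thesis .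
  qed
  have "(\<Sum>a\<in>A. w a * exp (t a)) ^ Suc n \<le> (\<Sum>a\<in>A. w a * exp (t a)) * (\<Sum>x\<in>?S. ?p x * exp (t x))"
    using Suc by (simp add: mult_left_mono sum_nonneg w_nonneg)
  also have "\<dots> = (\<Sum>a\<in>A. w a * exp (t a) * (\<Sum>x\<in>?S. ?p x * exp (t x)))"
    by (simp add: sum_distrib_right)
  also have "\<dots> \<le> (\<Sum>a\<in>A. w a * exp (t a) * (\<Sum>x\<in>?S'. ?p (x - a) * exp (t (x - a))))"
    by (intro sum_mono mult_left_mono le) (auto simp: w_nonneg)
  also have "\<dots> = (\<Sum>a\<in>A. \<Sum>x\<in>?S'. w a * ?p (x - a) * exp (t x))"
    by (simp add: sum_distrib_left additive.diff[OF t] exp_diff mult.assoc)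
  also have "\<dots> = (\<Sum>x\<in>?S'. point_weight A w (Suc n) x * exp (t x))"
    by (subst sum.swap) (simp add: sum_distrib_right)
  finally show ?case .
qed

text \<open>By the method of types: the sum of \<open>n\<close> values takes only polynomially many values.\<close>

lemma mgf_le_exp_of_tail_bound:
  assumes t: "Modules.additive t" and P: "0 \<in> P"
    and bound: "\<And>n x. tail_weight P A w n x \<le> exp (real n * k - t x)"
  shows "(\<Sum>a\<in>A. w a * exp (t a)) \<le> exp k"
proof (cases "(\<Sum>a\<in>A. w a * exp (t a)) \<le> 0")
  case True
  then show ?thesis using exp_ge_zero order_trans by blast
next
  case False
  define \<phi> where "\<phi> = (\<Sum>a\<in>A. w a * exp (t a))"
  have pos: "\<phi> > 0" using False by (simp add: \<phi>_def)
  have "ln \<phi> \<le> k + real (card A) * (ln (real n + 1) / real n)" if "n \<ge> 1" for n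
  proof -
    have "\<phi> ^ n \<le> (\<Sum>x\<in>count_sums A n. exp (real n * k))"
      unfolding \<phi>_def
    proof (rule order_trans[OF mgf_power_le_sum_point_weight[OF t]], rule sum_mono)
      fix x
      have "point_weight A w n x * exp (t x) \<le> exp (real n * k - t x) * exp (t x)"
        using order_trans[OF point_le_tail_weight[OF P] bound] by (intro mult_right_mono) auto
      then show "point_weight A w n x * exp (t x) \<le> exp (real n * k)" by (simp flip: exp_add)
    qed
    also have "\<dots> \<le> (real n + 1) ^ card A * exp (real n * k)"
      using of_nat_mono[OF card_count_sums[OF finite_A, of n], where 'a=real]
      by (simp add: mult_right_mono add.commute)
    finally have "ln (\<phi> ^ n) \<le> ln ((real n + 1) ^ card A * exp (real n * k))"
      using pos by (subst ln_le_cancel_iff) auto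
    then have "real n * ln \<phi> \<le> real (card A) * ln (real n + 1) + real n * k"
      using pos by (simp add: ln_realpow ln_mult)
    then show ?thesis using that by (simp add: field_simps)
  qed
  moreover have "(\<lambda>n. k + real (card A) * (ln (real n + 1) / real n)) \<longlonglongrightarrow> k + real (card A) * 0"
  proof (intro tendsto_intros)
    show "(\<lambda>n. ln (real n + 1) / real n) \<longlonglongrightarrow> 0" by real_asymp
  qed
  ultimately have "ln \<phi> \<le> k"
    by (intro LIMSEQ_le_const[where X = "\<lambda>n. k + real (card A) * (ln (real n + 1) / real n)"]) auto
  then have "exp (ln \<phi>) \<le> exp k" by simp
  then show ?thesis using pos by (simp flip: \<phi>_def)
qed

end

section \<open>Order units and Cramer's lower bound on orthants for finitely supported laws\<close>

locale order_unit_cone =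
  fixes P :: "'v::real_vector set" and u :: 'v
  assumes cone: "convex_cone P" and unit_pos: "u \<in> P" and order_unit: "\<And>x. \<exists>c. c *\<^sub>R u - x \<in> P"
begin

lemmas add_pos = convex_cone_add[OF cone]
lemmas scale_pos = convex_cone_scaleR[OF cone]

lemma zero_pos: "0 \<in> P" using cone by (simp add: convex_cone_iff)

lemma scale_unit_pos: "c \<ge> 0 \<Longrightarrow> c *\<^sub>R u \<in> P" by (simp add: scale_pos unit_pos)

lemma upper_bound: obtains c where "c \<ge> 0" "c *\<^sub>R u - x \<in> P"
proof -
  obtain c where "c *\<^sub>R u - x \<in> P" using order_unit by blast
  then have "c *\<^sub>R u - x + (max c 0 - c) *\<^sub>R u \<in> P" by (intro add_pos scale_unit_pos) auto
  then have "max c 0 *\<^sub>R u - x \<in> P" by (simp add: algebra_simps)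
  then show ?thesis using that[of "max c 0"] by simp
qed

lemma monotone_homs_iff:
  "t \<in> monotone_homs P \<longleftrightarrow> Modules.additive t \<and> (\<forall>x\<in>P. t x \<ge> 0)"
proof (cases "Modules.additive t")
  case True
  show ?thesis
  proof
    assume "t \<in> monotone_homs P"
    then have "t 0 \<le> t x" if "x \<in> P" for x
      using that monotoneD[of "cone_le P" "(\<le>)" t 0 x] by (simp add: monotone_homs_def cone_le_def)
    then show "Modules.additive t \<and> (\<forall>x\<in>P. t x \<ge> 0)" using True by (simp add: additive.zero)
  next
    assume t: "Modules.additive t \<and> (\<forall>x\<in>P. t x \<ge> 0)"
    have "t x \<le> t y" if "y - x \<in> P" for x y
      using t that additive.diff[OF True, of y x] by fastforce
    then show "t \<in> monotone_homs P"
      using True by (auto simp: monotone_homs_def cone_le_def monotone_def)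
  qed
qed (simp add: monotone_homs_def)

lemma monotone_homs_zero: "(\<lambda>_. 0) \<in> monotone_homs P"
  by (simp add: monotone_homs_iff additive.intro)

lemma monotone_homs_scale: "t \<in> monotone_homs P \<Longrightarrow> c \<ge> 0 \<Longrightarrow> (\<lambda>x. c * t x) \<in> monotone_homs P"
  by (auto simp: monotone_homs_iff Modules.additive_def algebra_simps)

lemma tail_weight_antimono:
  assumes "finite_weights A w" and "y - x \<in> P"
  shows "tail_weight P A w n y \<le> tail_weight P A w n x"
  using assms(2)
proof (induction n arbitrary: x y)
  case 0
  have "- x = - y + (y - x)" by simp
  then have "- y \<in> P \<Longrightarrow> - x \<in> P" using add_pos[of "- y" "y - x"] 0 by simp
  then show ?case by auto
next
  case (Suc n)
  then show ?case
    using finite_weights.w_nonneg[OF assms(1)] by (auto intro!: sum_mono mult_left_mono)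
qed

text \<open>Two successive blocks of draws are independent, and if they dominate \<open>x\<close>
  and \<open>y\<close> then together they dominate \<open>x + y\<close>.\<close>

lemma tail_weight_superadditive:
  assumes "finite_weights A w"
  shows "tail_weight P A w n x * tail_weight P A w m y \<le> tail_weight P A w (n + m) (x + y)"
proof (induction n arbitrary: x)
  case 0
  show ?case
    using tail_weight_antimono[OF assms, of y "x + y" m] finite_weights.tail_weight_nonneg[OF assms]
    by auto
next
  case (Suc n)
  have "tail_weight P A w n (x - a) * tail_weight P A w m y \<le> tail_weight P A w (n + m) (x + y - a)" for a
    using Suc[of "x - a"] by (simp add: algebra_simps)
  then show ?case
    using finite_weights.w_nonneg[OF assms]
    by (auto simp: sum_distrib_right mult.assoc intro!: sum_mono mult_left_mono)
qed

lemma tail_weight_power: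
  assumes "finite_weights A w"
  shows "tail_weight P A w n x ^ k \<le> tail_weight P A w (k * n) (real k *\<^sub>R x)"
proof (induction k)
  case 0
  then show ?case by (simp add: zero_pos)
next
  case (Suc k)
  have "tail_weight P A w n x ^ Suc k \<le> tail_weight P A w n x * tail_weight P A w (k * n) (real k *\<^sub>R x)"
    using Suc finite_weights.tail_weight_nonneg[OF assms] by (simp add: mult_left_mono)
  also have "\<dots> \<le> tail_weight P A w (n + k * n) (x + real k *\<^sub>R x)"
    by (rule tail_weight_superadditive[OF assms])
  finally show ?case by (simp add: algebra_simps)
qed

text \<open>Each draw dominates \<open>- r *\<^sub>R u\<close>, so \<open>n\<close> draws surely
  dominate \<open>- (n * r) *\<^sub>R u\<close>, which dominates \<open>x\<close>. This lets an
  incomplete block be added at no cost in probability.\<close>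

lemma tail_weight_eq_1:
  assumes "finite_weights A w" and "\<And>a. a \<in> A \<Longrightarrow> a + r *\<^sub>R u \<in> P" and "- x - (real n * r) *\<^sub>R u \<in> P"
  shows "tail_weight P A w n x = 1"
  using assms(3)
proof (induction n arbitrary: x)
  case 0
  then show ?case by simp
next
  case (Suc n)
  have "tail_weight P A w n (x - a) = 1" if "a \<in> A" for a
  proof (rule Suc.IH)
    show "- (x - a) - (real n * r) *\<^sub>R u \<in> P"
      using add_pos[OF Suc.prems assms(2)[OF that]] by (simp add: algebra_simps)
  qed
  then show ?case using finite_weights.w_sum[OF assms(1)] by simp
qed

text \<open>Elements of \<open>monotone_homs\<close> are mere group homomorphisms; real homogeneity
  along \<open>u\<close> is a consequence of monotonicity.\<close>

lemma monotone_hom_scale_unit: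
  assumes t: "t \<in> monotone_homs P"
  shows "t (c *\<^sub>R u) = c * t u"
proof -
  have add: "Modules.additive (\<lambda>c. t (c *\<^sub>R u))"
    using t by (auto simp: monotone_homs_iff Modules.additive_def algebra_simps)
  have "mono (\<lambda>c. t (c *\<^sub>R u))"
  proof (rule monoI)
    fix x y :: real assume "x \<le> y"
    then have "y *\<^sub>R u - x *\<^sub>R u \<in> P" using scale_unit_pos[of "y - x"] by (simp add: algebra_simps)
    then show "t (x *\<^sub>R u) \<le> t (y *\<^sub>R u)"
      using t by (auto simp: monotone_homs_def monotone_def cone_le_def)
  qed
  from additive_mono_real_linear[OF add this, of c] show ?thesis by simp
qed

text \<open>The pairs \<open>(x - n (z - \<delta> u), b - n (c - \<delta>))\<close> with \<open>exp b \<le> tail_weight P A w n x\<close> form a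
  semigroup in \<open>V \<times> \<real>\<close>. If it stayed away from the positive cone, a positive functional \<open>(t, \<tau>)\<close>
  nonpositive on it would exist; after normalising to \<open>\<tau> = 1\<close>, the functional \<open>t\<close> violates the
  assumption.\<close>

lemma exists_tail_weight_ge:
  assumes fw: "finite_weights A w" and \<delta>: "\<delta> > 0"
    and mgf: "\<And>t. t \<in> monotone_homs P \<Longrightarrow> exp (t z + c) \<le> (\<Sum>a\<in>A. w a * exp (t a))"
  shows "\<exists>n\<ge>1. exp (real n * (c - \<delta>)) \<le> tail_weight P A w n (real n *\<^sub>R (z - \<delta> *\<^sub>R u))"
proof (rule ccontr)
  assume "\<not> ?thesis"
  then have contra: "tail_weight P A w n (real n *\<^sub>R (z - \<delta> *\<^sub>R u)) < exp (real n * (c - \<delta>))" if "n \<ge> 1" for n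
    using that by auto
  let ?tw = "tail_weight P A w"
  define T where "T = {(x - real n *\<^sub>R (z - \<delta> *\<^sub>R u), b - real n * (c - \<delta>)) | x b n. exp b \<le> ?tw n x}"
  \<comment> \<open>The slack \<delta> in \<open>T\<close> is taken along this same order unit of
    the product cone. Normalising \<open>l f = 1\<close> therefore turns it into exactly \<delta>
    per draw, however \<open>l\<close> splits between the two factors.\<close>
  define f where "f = (u, 1::real)"
  have TI: "(x - real n *\<^sub>R (z - \<delta> *\<^sub>R u), b - real n * (c - \<delta>)) \<in> T" if "exp b \<le> ?tw n x" for x b n
    using that by (auto simp: T_def)
  have coneF: "convex_cone (P \<times> {0::real..})"
    using cone unfolding convex_cone_iff by (auto simp: zero_prod_def)
  have unitF: "\<exists>d. d *\<^sub>R f - x \<in> P \<times> {0..}" for x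
  proof -
    obtain d where d: "d *\<^sub>R u - fst x \<in> P" using order_unit by blast
    have "d *\<^sub>R u - fst x + (max d (snd x) - d) *\<^sub>R u \<in> P" by (intro add_pos d scale_unit_pos) simp
    then have "max d (snd x) *\<^sub>R u - fst x \<in> P" by (simp add: algebra_simps)
    then have "max d (snd x) *\<^sub>R f - x \<in> P \<times> {0..}"
      by (cases x) (auto simp: f_def)
    then show ?thesis by (rule exI)
  qed
  have T0: "0 \<in> T"
    using TI[of 0 0 0] zero_pos by (simp add: zero_prod_def)
  have Tadd: "p + q \<in> T" if pq: "p \<in> T" "q \<in> T" for p q
  proof -
    from pq(1) obtain x b n where p: "p = (x - real n *\<^sub>R (z - \<delta> *\<^sub>R u), b - real n * (c - \<delta>))" "exp b \<le> ?tw n x"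
      by (auto simp: T_def)
    from pq(2) obtain y d m where q: "q = (y - real m *\<^sub>R (z - \<delta> *\<^sub>R u), d - real m * (c - \<delta>))" "exp d \<le> ?tw m y"
      by (auto simp: T_def)
    have "exp (b + d) \<le> ?tw n x * ?tw m y"
      unfolding exp_add using p q finite_weights.tail_weight_nonneg[OF fw] by (intro mult_mono) auto
    also have "\<dots> \<le> ?tw (n + m) (x + y)" by (rule tail_weight_superadditive[OF fw])
    finally show ?thesis using TI[of "b + d" "n + m" "x + y"] by (simp add: p q algebra_simps)
  qed
  have Tneg: "p - d *\<^sub>R f \<notin> P \<times> {0..}" if pT: "p \<in> T" and d: "d > 0" for p d
  proof
    assume mem: "p - d *\<^sub>R f \<in> P \<times> {0..}"
    from pT obtain x b n where p: "p = (x - real n *\<^sub>R (z - \<delta> *\<^sub>R u), b - real n * (c - \<delta>))" "exp b \<le> ?tw n x"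
      by (auto simp: T_def)
    from mem have 1: "x - real n *\<^sub>R (z - \<delta> *\<^sub>R u) - d *\<^sub>R u \<in> P" and 2: "real n * (c - \<delta>) + d \<le> b"
      by (auto simp: p f_def)
    show False
    proof (cases "n = 0")
      \<comment> \<open>The assumption for contradiction says nothing about \<open>n = 0\<close>;
        there a tail weight is at most 1, so \<open>b \<le> 0 < d\<close>.\<close>
      case True
      have "exp b \<le> 1" using p(2) finite_weights.tail_weight_le_1[OF fw, of P n x] by linarith
      then show False using 2 d True by simp
    next
      case False
      have "x - real n *\<^sub>R (z - \<delta> *\<^sub>R u) \<in> P"
        using add_pos[OF 1 scale_unit_pos[of d]] d by simp
      then have "exp b \<le> ?tw n (real n *\<^sub>R (z - \<delta> *\<^sub>R u))"
        using tail_weight_antimono[OF fw] p(2) order_trans by blast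
      also have "\<dots> < exp (real n * (c - \<delta>))" using contra[of n] False by simp
      finally show False using 2 d by simp
    qed
  qed
  obtain l where l: "Modules.additive l" "\<And>x. x \<in> P \<times> {0..} \<Longrightarrow> l x \<ge> 0" "\<And>c. l (c *\<^sub>R f) = c"
    "\<And>x. x \<in> T \<Longrightarrow> l x \<le> 0"
    using positive_functional_nonpos_on_semigroup[OF coneF unitF T0 Tadd Tneg] by blast
  define t where "t x = l (x, 0)" for x
  define \<tau> where "\<tau> = l (0, 1)"
  have t: "t \<in> monotone_homs P"
    using l(2) additive.add[OF l(1), of "(_, 0)" "(_, 0)"]
    by (auto simp: monotone_homs_iff Modules.additive_def t_def)
  have \<tau>: "\<tau> \<ge> 0" using l(2)[of "(0, 1)"] zero_pos by (simp add: \<tau>_def)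
  have l_snd: "l (0, b) = b * l (0, 1)" for b
  proof (rule additive_mono_real_linear)
    show "Modules.additive (\<lambda>b. l (0, b))"
      using additive.add[OF l(1), of "(0, _)" "(0, _)"] by (auto simp: Modules.additive_def)
    show "mono (\<lambda>b. l (0, b))"
    proof (rule monoI)
      fix x y :: real assume "x \<le> y"
      then have "l ((0, y) - (0, x)) \<ge> 0" by (intro l(2)) (simp add: zero_pos)
      then show "l (0, x) \<le> l (0, y)" unfolding additive.diff[OF l(1)] by simp
    qed
  qed
  have l_eq: "l (x, b) = t x + b * \<tau>" for x b
    using additive.add[OF l(1), of "(x, 0)" "(0, b)"] by (simp add: t_def \<tau>_def l_snd[of b])
  note t_simps = additive.add[of t] additive.diff[of t] additive_scale_nat[of t] monotone_hom_scale_unit[OF t]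
  have addt: "Modules.additive t" using t by (simp add: monotone_homs_def)
  have norm: "t u + \<tau> = 1" using l(3)[of 1] l_eq[of u 1] by (simp add: f_def)
  have key: "t x + b * \<tau> \<le> real n * (t z + c * \<tau> - \<delta>)" if "exp b \<le> ?tw n x" for x b n
  proof -
    have "t x - real n * (t z - \<delta> * t u) + (b - real n * (c - \<delta>)) * \<tau> \<le> 0"
      using l(4)[OF TI[OF that]] by (simp add: l_eq t_simps addt)
    then have "t x + b * \<tau> \<le> real n * (t z + c * \<tau> - \<delta> * (t u + \<tau>))" by (simp add: algebra_simps)
    then show ?thesis by (simp add: norm)
  qed
  have "\<exists>s \<eta>. s \<in> monotone_homs P \<and> \<eta> > 0 \<and>
          (\<forall>n x b. exp b \<le> ?tw n x \<longrightarrow> s x + b \<le> real n * (s z + c - \<eta>))"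
  \<comment> \<open>A vertical functional cannot be normalised. It bounds \<open>t x\<close> by
    \<open>n * (t z - \<delta>)\<close> without involving probabilities, so a large multiple
    \<open>k * t\<close> gains \<open>k * \<delta>\<close> per draw, more than \<open>- c\<close>;
    the term \<open>b\<close> is harmless because \<open>b \<le> 0\<close>.\<close>
  proof (cases "\<tau> = 0")
    case True
    obtain k :: nat where k: "- c < real k * \<delta>" using reals_Archimedean3[OF \<delta>] by blast
    have "real k * t x + b \<le> real n * (real k * t z + c - (real k * \<delta> + c))"
      if "exp b \<le> ?tw n x" for x b n
    proof -
      have "exp b \<le> 1" using that finite_weights.tail_weight_le_1[OF fw, of P n x] by linarith
      moreover have "real k * t x \<le> real k * (real n * (t z - \<delta>))"
        using key[OF that] True by (intro mult_left_mono) auto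
      ultimately show ?thesis by (simp add: algebra_simps)
    qed
    then show ?thesis
      using k by (intro exI[of _ "\<lambda>x. real k * t x"] exI[of _ "real k * \<delta> + c"])
        (auto intro!: monotone_homs_scale t)
  next
    case False
    then have pos: "\<tau> > 0" using \<tau> by simp
    have "1 / \<tau> * t x + b \<le> real n * (1 / \<tau> * t z + c - \<delta> / \<tau>)" if "exp b \<le> ?tw n x" for x b n
    proof -
      have "(t x + b * \<tau>) / \<tau> \<le> (real n * (t z + c * \<tau> - \<delta>)) / \<tau>"
        using key[OF that] pos by (intro divide_right_mono) auto
      also have "(t x + b * \<tau>) / \<tau> = 1 / \<tau> * t x + b" using pos by (simp add: add_divide_distrib)
      also have "(real n * (t z + c * \<tau> - \<delta>)) / \<tau> = real n * (1 / \<tau> * t z + c - \<delta> / \<tau>)"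
        using pos by (simp add: field_simps)
      finally show ?thesis .
    qed
    moreover have "(\<lambda>x. 1 / \<tau> * t x) \<in> monotone_homs P"
      using pos by (intro monotone_homs_scale t) simp
    moreover have "\<delta> / \<tau> > 0" using pos \<delta> by simp
    ultimately show ?thesis by blast
  qed
  then obtain s \<eta> where s: "s \<in> monotone_homs P" and \<eta>: "\<eta> > 0"
    and s_le: "\<And>n x b. exp b \<le> ?tw n x \<Longrightarrow> s x + b \<le> real n * (s z + c - \<eta>)" by blast
  have "(\<Sum>a\<in>A. w a * exp (s a)) \<le> exp (s z + c - \<eta>)"
  proof (rule finite_weights.mgf_le_exp_of_tail_bound[OF fw _ zero_pos])
    show "Modules.additive s" using s by (simp add: monotone_homs_def)
    fix n x
    show "?tw n x \<le> exp (real n * (s z + c - \<eta>) - s x)"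
    proof (cases "?tw n x > 0")
      case True
      then show ?thesis using s_le[of "ln (?tw n x)" n x] by (subst ln_le_cancel_iff[symmetric]) auto
    next
      case False
      then show ?thesis using exp_ge_zero order_trans not_less by metis
    qed
  qed
  also have "\<dots> < exp (s z + c)" using \<eta> by simp
  finally show False using mgf[OF s] by linarith
qed

text \<open>One good block length \<open>m\<close> is extended to all large \<open>n\<close> by
  \<open>n div m\<close> blocks and a remainder. The bounded deficit of the remainder is absorbed by
  a second slack \<open>n * \<delta>\<close>, which explains the factor 2.\<close>

lemma eventually_tail_weight_ge:
  assumes fw: "finite_weights A w" and \<delta>: "\<delta> > 0"
    and mgf: "\<And>t. t \<in> monotone_homs P \<Longrightarrow> exp (t z + c) \<le> (\<Sum>a\<in>A. w a * exp (t a))"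
  shows "\<forall>\<^sub>F n in sequentially. exp (real n * (c - \<delta>)) \<le> tail_weight P A w n (real n *\<^sub>R (z - (2 * \<delta>) *\<^sub>R u))"
proof -
  let ?tw = "tail_weight P A w"
  define y where "y = z - \<delta> *\<^sub>R u"
  obtain m where m: "m \<ge> 1" "exp (real m * (c - \<delta>)) \<le> ?tw m (real m *\<^sub>R y)"
    using exists_tail_weight_ge[OF fw \<delta> mgf] by (auto simp: y_def)
  \<comment> \<open>The case \<open>t = 0\<close> of the hypothesis. It ensures that rounding
    \<open>n\<close> down to a multiple of \<open>m\<close> only increases the exponential
    bound.\<close>
  have c: "c \<le> 0"
    using mgf[OF monotone_homs_zero] finite_weights.w_sum[OF fw] by simp
  obtain B where B: "B \<ge> 0" "B *\<^sub>R u - y \<in> P" by (rule upper_bound)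
  have "\<exists>R\<ge>0. \<forall>a\<in>A. a + R *\<^sub>R u \<in> P"
    using finite_weights.finite_A[OF fw]
  proof (induction A rule: finite_induct)
    case empty
    then show ?case by auto
  next
    case (insert a A)
    then obtain R where R: "R \<ge> 0" "\<forall>a\<in>A. a + R *\<^sub>R u \<in> P" by auto
    obtain d where d: "d \<ge> 0" "d *\<^sub>R u - (- a) \<in> P" by (rule upper_bound)
    have "a + (R + d) *\<^sub>R u \<in> P"
      using add_pos[OF d(2) scale_unit_pos[OF R(1)]] by (simp add: algebra_simps)
    moreover have "b + (R + d) *\<^sub>R u \<in> P" if "b \<in> A" for b
      using add_pos[OF R(2)[rule_format, OF that] scale_unit_pos[OF d(1)]] by (simp add: algebra_simps)
    ultimately show ?case using R d by (intro exI[of _ "R + d"]) auto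
  qed
  then obtain R where R: "R \<ge> 0" "\<And>a. a \<in> A \<Longrightarrow> a + R *\<^sub>R u \<in> P" by auto
  \<comment> \<open>In units of \<open>u\<close>, each remaining draw falls short by at most
    \<open>R\<close> below zero and \<open>B\<close> for its target \<open>y\<close>.\<close>
  obtain n0 :: nat where n0: "real m * (R + B) < real n0 * \<delta>" using reals_Archimedean3[OF \<delta>] by blast
  have "exp (real n * (c - \<delta>)) \<le> ?tw n (real n *\<^sub>R (y - \<delta> *\<^sub>R u))" if n: "n \<ge> n0" for n
  proof -
    define q where "q = n div m"
    define r where "r = n mod m"
    have qr: "n = q * m + r" and r: "r \<le> m" using m(1) by (simp_all add: q_def r_def less_imp_le)
    have "real r * (R + B) \<le> real m * (R + B)" using r R B by (intro mult_right_mono) auto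
    also have "\<dots> \<le> real n * \<delta>" using n0 mult_right_mono[of "real n0" "real n" \<delta>] n \<delta> by linarith
    finally have le: "0 \<le> real n * \<delta> - real r * B - real r * R" by (simp add: algebra_simps)
    \<comment> \<open>The target left for the remainder: together with \<open>q * m\<close> copies
      of \<open>y\<close> it makes \<open>n\<close> copies of
      \<open>y - \<delta> *\<^sub>R u\<close>.\<close>
    define x where "x = real r *\<^sub>R y - (real n * \<delta>) *\<^sub>R u"
    have "real r *\<^sub>R (B *\<^sub>R u - y) + (real n * \<delta> - real r * B - real r * R) *\<^sub>R u \<in> P"
      by (intro add_pos scale_pos B scale_unit_pos le) auto
    then have "- x - (real r * R) *\<^sub>R u \<in> P"
      by (simp add: x_def algebra_simps)
    then have one: "?tw r x = 1" by (intro tail_weight_eq_1[OF fw R(2)])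
    have "exp (real n * (c - \<delta>)) \<le> exp (real (q * m) * (c - \<delta>))"
      using c \<delta> qr by (subst exp_le_cancel_iff, intro mult_right_mono_neg) auto
    also have "\<dots> = exp (real m * (c - \<delta>)) ^ q" by (simp add: exp_of_nat_mult[symmetric] algebra_simps)
    also have "\<dots> \<le> ?tw m (real m *\<^sub>R y) ^ q" using m(2) by (rule power_mono) simp
    also have "\<dots> \<le> ?tw (q * m) (real q *\<^sub>R real m *\<^sub>R y) * ?tw r x"
      unfolding one mult_1_right by (rule tail_weight_power[OF fw])
    also have "\<dots> \<le> ?tw (q * m + r) (real q *\<^sub>R real m *\<^sub>R y + x)"
      by (rule tail_weight_superadditive[OF fw])
    also have "real q *\<^sub>R real m *\<^sub>R y + x = real n *\<^sub>R (y - \<delta> *\<^sub>R u)"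
      by (simp add: x_def qr algebra_simps)
    finally show ?thesis using qr by simp
  qed
  moreover have "y - \<delta> *\<^sub>R u = z - (2 * \<delta>) *\<^sub>R u" by (simp add: y_def algebra_simps flip: scaleR_add_left)
  ultimately show ?thesis by (auto simp: eventually_sequentially)
qed

end

section \<open>Order-unit seminorms and discretisation\<close>

lemma tendsto_scaleR_tvs:
  fixes g :: "'b \<Rightarrow> 'v::real_tvs"
  assumes "(f \<longlongrightarrow> r) F" and "(g \<longlongrightarrow> a) F"
  shows "((\<lambda>x. f x *\<^sub>R g x) \<longlongrightarrow> r *\<^sub>R a) F"
  using filterlim_compose[OF tendsto_scaleR_Pair filterlim_Pair[OF assms]] by simp

lemma continuous_on_scaleR_const:
  "continuous_on S (\<lambda>x::'v::real_tvs. c *\<^sub>R x)"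
  by (auto simp: continuous_on_def intro!: tendsto_scaleR_tvs tendsto_ident_at)

text \<open>The points \<open>x / n\<close> tend to zero by continuity of scaling, so one of them
  lies in the order interval.\<close>

lemma order_unit_of_interior:
  fixes P :: "'v::real_tvs set"
  assumes P: "convex_cone P" and int: "0 \<in> interior (cone_interval P (- u) u)"
  shows "\<exists>c. c *\<^sub>R u - x \<in> P"
proof -
  have "((\<lambda>n. (1 / real (Suc n)) *\<^sub>R x) \<longlongrightarrow> 0 *\<^sub>R x) sequentially"
    by (intro tendsto_scaleR_tvs tendsto_const) real_asymp
  then have "\<forall>\<^sub>F n in sequentially. (1 / real (Suc n)) *\<^sub>R x \<in> interior (cone_interval P (- u) u)"
    using int by (intro topological_tendstoD) auto
  then obtain n where "(1 / real (Suc n)) *\<^sub>R x \<in> interior (cone_interval P (- u) u)"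
    by (auto simp: eventually_sequentially)
  then have "u - (1 / real (Suc n)) *\<^sub>R x \<in> P"
    using interior_subset by (auto simp: cone_interval_def cone_le_def)
  then have "real (Suc n) *\<^sub>R (u - (1 / real (Suc n)) *\<^sub>R x) \<in> P"
    by (intro convex_cone_scaleR[OF P]) auto
  then have "real (Suc n) *\<^sub>R u - x \<in> P" by (simp only: scaleR_diff_right) simp
  then show ?thesis by blast
qed

context order_unit_cone
begin

text \<open>The order-unit seminorm in relational form,
  \<open>x - y \<in> [- \<delta> u, \<delta> u]\<close>; errors can be added and scaled without
  handling an infimum.\<close>

definition close :: "real \<Rightarrow> 'v \<Rightarrow> 'v \<Rightarrow> bool" where
  "close \<delta> x y \<longleftrightarrow> \<delta> *\<^sub>R u - (x - y) \<in> P \<and> \<delta> *\<^sub>R u + (x - y) \<in> P"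

lemma close_add: "close \<delta> x y \<Longrightarrow> close \<eta> x' y' \<Longrightarrow> close (\<delta> + \<eta>) (x + x') (y + y')"
  unfolding close_def
  using add_pos[of "\<delta> *\<^sub>R u - (x - y)" "\<eta> *\<^sub>R u - (x' - y')"]
    add_pos[of "\<delta> *\<^sub>R u + (x - y)" "\<eta> *\<^sub>R u + (x' - y')"]
  by (simp add: algebra_simps)

lemma close_trans: "close \<delta> x y \<Longrightarrow> close \<eta> y z \<Longrightarrow> close (\<delta> + \<eta>) x z"
  using close_add[of \<delta> x y \<eta> y z] by (simp add: close_def algebra_simps)

lemma close_mono: "close \<delta> x y \<Longrightarrow> \<delta> \<le> \<eta> \<Longrightarrow> close \<eta> x y"
  unfolding close_def
  using add_pos[of "\<delta> *\<^sub>R u - (x - y)" "(\<eta> - \<delta>) *\<^sub>R u"] add_pos[of "\<delta> *\<^sub>R u + (x - y)" "(\<eta> - \<delta>) *\<^sub>R u"]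
    scale_unit_pos[of "\<eta> - \<delta>"]
  by (simp add: algebra_simps)

lemma close_scale: "close \<delta> x y \<Longrightarrow> close (\<bar>c\<bar> * \<delta>) (c *\<^sub>R x) (c *\<^sub>R y)"
  unfolding close_def
  using scale_pos[of "\<bar>c\<bar>" "\<delta> *\<^sub>R u - (x - y)"] scale_pos[of "\<bar>c\<bar>" "\<delta> *\<^sub>R u + (x - y)"]
  by (cases "c \<ge> 0") (auto simp: algebra_simps)

lemma close_refl: "close 0 x x"
  by (simp add: close_def zero_pos)

lemma close_sum:
  assumes "finite I" and "\<And>i. i \<in> I \<Longrightarrow> close (\<delta> i) (x i) (y i)"
  shows "close (sum \<delta> I) (sum x I) (sum y I)"
  using assms by (induction I rule: finite_induct) (auto simp: close_refl close_add)

lemma close_average: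
  assumes n: "n \<ge> 1" and "\<And>i. i \<in> {1..n} \<Longrightarrow> close \<delta> (x i) (y i)"
  shows "close \<delta> ((1 / real n) *\<^sub>R (\<Sum>i=1..n. x i)) ((1 / real n) *\<^sub>R (\<Sum>i=1..n. y i))"
  using close_scale[OF close_sum[of "{1..n}" "\<lambda>_. \<delta>" x y], of "1 / real n"] assms by simp

lemma exists_close_zero: obtains c where "c \<ge> 0" "close c x 0"
proof -
  obtain c where c: "c \<ge> 0" "c *\<^sub>R u - x \<in> P" by (rule upper_bound)
  obtain d where d: "d \<ge> 0" "d *\<^sub>R u - (- x) \<in> P" by (rule upper_bound)
  have "c *\<^sub>R u - x + d *\<^sub>R u \<in> P" "d *\<^sub>R u + x + c *\<^sub>R u \<in> P"
    using c d by (auto intro!: add_pos scale_unit_pos)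
  then show ?thesis using c d by (intro that[of "c + d"]) (auto simp: close_def algebra_simps)
qed

lemma finite_close_zero:
  assumes "finite A"
  obtains c where "c \<ge> 0" "\<And>a. a \<in> A \<Longrightarrow> close c a 0"
proof -
  have "\<exists>c\<ge>0. \<forall>a\<in>A. close c a 0"
    using assms
  proof (induction A rule: finite_induct)
    case empty
    then show ?case by auto
  next
    case (insert a A)
    then obtain c where "c \<ge> 0" "\<forall>a\<in>A. close c a 0" by auto
    moreover obtain d where "d \<ge> 0" "close d a 0" by (rule exists_close_zero)
    ultimately show ?case by (intro exI[of _ "max c d"]) (auto intro: close_mono)
  qed
  then show ?thesis using that by blast
qed

lemma monotone_hom_close:
  assumes t: "t \<in> monotone_homs P" and xy: "close \<delta> x y"
  shows "\<bar>t x - t y\<bar> \<le> \<delta> * t u"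
proof -
  have add: "Modules.additive t" and pos: "\<And>x. x \<in> P \<Longrightarrow> t x \<ge> 0"
    using t by (auto simp: monotone_homs_iff)
  have "t (\<delta> *\<^sub>R u - (x - y)) \<ge> 0" "t (\<delta> *\<^sub>R u + (x - y)) \<ge> 0"
    using xy by (auto simp: close_def intro!: pos)
  then show ?thesis
    unfolding additive.diff[OF add] additive.add[OF add] monotone_hom_scale_unit[OF t] by linarith
qed

text \<open>An average of \<open>n\<close> points of \<open>A\<close> is a convex combination of \<open>A\<close>, whose coefficients are rounded
  down to multiples of \<open>1 / L\<close>.\<close>

lemma finite_net_of_averages:
  assumes A: "finite A" and \<delta>: "\<delta> > 0"
  obtains Z where "finite Z"
    "\<And>n f. n \<ge> 1 \<Longrightarrow> (\<And>i. i \<in> {1..n} \<Longrightarrow> f i \<in> A) \<Longrightarrow> \<exists>z\<in>Z. close \<delta> ((1 / real n) *\<^sub>R (\<Sum>i=1..n. f i)) z"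
proof -
  obtain R where R: "R \<ge> 0" "\<And>a. a \<in> A \<Longrightarrow> close R a 0" using finite_close_zero[OF A] by blast
  \<comment> \<open>Rounding changes each of the \<open>card A\<close> coefficients by at most
    \<open>1 / L\<close>, and each point has size at most \<open>R\<close>.\<close>
  obtain L0 :: nat where L0: "real (card A) * R < real L0 * \<delta>" using reals_Archimedean3[OF \<delta>] by blast
  define L where "L = max 1 L0"
  have "real L0 * \<delta> \<le> real L * \<delta>" using \<delta> by (intro mult_right_mono) (auto simp: L_def)
  then have L: "L \<ge> 1" "real (card A) * R \<le> real L * \<delta>"
    using L0 by (simp_all add: L_def del: of_nat_max)
  define Z where "Z = (\<lambda>c. \<Sum>a\<in>A. (real (c a) / real L) *\<^sub>R a) ` (A \<rightarrow>\<^sub>E {..L})"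
  show ?thesis
  proof (rule that[of Z])
    show "finite Z" unfolding Z_def using A by (intro finite_imageI finite_PiE) auto
    fix n :: nat and f :: "nat \<Rightarrow> 'v" assume n: "n \<ge> 1" and f: "\<And>i. i \<in> {1..n} \<Longrightarrow> f i \<in> A"
    define m where "m a = card {i\<in>{1..n}. f i = a}" for a
    define c where "c = (\<lambda>a\<in>A. L * m a div n)"
    have m_le: "m a \<le> n" for a
      unfolding m_def by (rule order_trans[OF card_mono[of "{1..n}"]]) auto
    have c_le: "c a \<le> L" if "a \<in> A" for a
    proof -
      have "L * m a div n \<le> L * n div n" by (intro div_le_mono mult_le_mono m_le order_refl)
      then show ?thesis using that n by (simp add: c_def)
    qed
    have "(\<Sum>i=1..n. f i) = (\<Sum>a\<in>A. \<Sum>i\<in>{i\<in>{1..n}. f i = a}. f i)"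
      by (rule sum.group[symmetric]) (use A f in auto)
    also have "\<dots> = (\<Sum>a\<in>A. real (m a) *\<^sub>R a)" by (simp add: m_def sum_constant_scaleR)
    finally have avg: "(1 / real n) *\<^sub>R (\<Sum>i=1..n. f i) = (\<Sum>a\<in>A. (real (m a) / real n) *\<^sub>R a)"
      by (simp add: scaleR_sum_right)
    have "close (R / real L) ((real (m a) / real n) *\<^sub>R a) ((real (c a) / real L) *\<^sub>R a)" if "a \<in> A" for a
    proof -
      define r where "r = real (m a) / real n - real (c a) / real L"
      have "L * m a = n * c a + L * m a mod n" using that by (simp add: c_def)
      moreover have "L * m a mod n < n" using n by simp
      ultimately have "n * c a \<le> L * m a" "L * m a \<le> n * c a + n" by linarith+
      then have "real (n * c a) \<le> real (L * m a)" "real (L * m a) \<le> real (n * c a + n)"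
        by (simp_all only: of_nat_le_iff)
      then have "real n * real (c a) \<le> real L * real (m a)" "real L * real (m a) \<le> real n * real (c a) + real n"
        by simp_all
      moreover have r_eq: "r = (real L * real (m a) - real n * real (c a)) / (real n * real L)"
        using n L by (simp add: r_def field_simps)
      ultimately have "0 \<le> r" "r \<le> 1 / real L"
        using n L divide_right_mono[of "real L * real (m a) - real n * real (c a)" "real n" "real n * real L"]
        unfolding r_eq by auto
      then have r: "\<bar>r\<bar> * R \<le> R / real L" using mult_right_mono[of r "1 / real L" R] R(1) by simp
      have "close (R / real L) (r *\<^sub>R a) 0"
        using close_mono[OF close_scale[OF R(2)[OF that], of r] r] by simp
      then have "close (R / real L + 0) (r *\<^sub>R a + (real (c a) / real L) *\<^sub>R a) (0 + (real (c a) / real L) *\<^sub>R a)"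
        by (intro close_add close_refl)
      then show ?thesis by (simp add: r_def algebra_simps)
    qed
    then have "close (\<Sum>a\<in>A. R / real L) (\<Sum>a\<in>A. (real (m a) / real n) *\<^sub>R a) (\<Sum>a\<in>A. (real (c a) / real L) *\<^sub>R a)"
      by (intro close_sum A)
    moreover have "(\<Sum>a\<in>A. R / real L) \<le> \<delta>" using L by (simp add: field_simps)
    ultimately have "close \<delta> ((1 / real n) *\<^sub>R (\<Sum>i=1..n. f i)) (\<Sum>a\<in>A. (real (c a) / real L) *\<^sub>R a)"
      unfolding avg by (rule close_mono)
    moreover have "c \<in> A \<rightarrow>\<^sub>E {..L}" using c_le by (auto simp: c_def)
    ultimately show "\<exists>z\<in>Z. close \<delta> ((1 / real n) *\<^sub>R (\<Sum>i=1..n. f i)) z" by (auto simp: Z_def)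
  qed
qed

end

section \<open>Automatic continuity and rounding to finitely many points\<close>

locale order_unit_cone_tvs = order_unit_cone P u for P :: "'v::real_tvs set" and u +
  assumes closed_cone: "closed P" and interval_nhd: "0 \<in> interior (cone_interval P (- u) u)"
begin

lemma open_nhd_close:
  assumes "\<delta> > 0"
  obtains U where "open U" "0 \<in> U" "\<And>x y. x - y \<in> U \<Longrightarrow> close \<delta> x y"
proof -
  define U where "U = (\<lambda>x. (1 / \<delta>) *\<^sub>R x) -` interior (cone_interval P (- u) u)"
  have "close \<delta> x y" if "x - y \<in> U" for x y
  proof -
    have "(1 / \<delta>) *\<^sub>R (x - y) \<in> cone_interval P (- u) u"
      using that interior_subset by (auto simp: U_def)
    then have "u - (1 / \<delta>) *\<^sub>R (x - y) \<in> P" "u + (1 / \<delta>) *\<^sub>R (x - y) \<in> P"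
      by (auto simp: cone_interval_def cone_le_def add.commute)
    then have "\<delta> *\<^sub>R (u - (1 / \<delta>) *\<^sub>R (x - y)) \<in> P" "\<delta> *\<^sub>R (u + (1 / \<delta>) *\<^sub>R (x - y)) \<in> P"
      using assms by (auto intro: scale_pos)
    then show ?thesis
      using assms unfolding close_def scaleR_add_right scaleR_diff_right by simp
  qed
  moreover have "open U"
    unfolding U_def by (intro open_vimage continuous_on_scaleR_const) auto
  moreover have "0 \<in> U" using interval_nhd by (simp add: U_def)
  ultimately show ?thesis using that by blast
qed

text \<open>Monotone homomorphisms are Lipschitz with constant \<open>t u\<close> for the seminorm
  of \<open>u\<close>, whose balls are neighbourhoods. This makes their half-spaces closed and their
  values on a sample measurable.\<close>

lemma monotone_hom_continuous:
  assumes t: "t \<in> monotone_homs P"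
  shows "continuous_on UNIV t"
  unfolding continuous_on_def tendsto_iff
proof (intro ballI allI impI)
  fix x :: 'v and e :: real assume e: "e > 0"
  have tu: "t u \<ge> 0" using t unit_pos by (simp add: monotone_homs_iff)
  \<comment> \<open>The summand 1 guards against \<open>t u = 0\<close>.\<close>
  define \<delta> where "\<delta> = e / (t u + 1)"
  have \<delta>: "\<delta> > 0" using tu e by (simp add: \<delta>_def)
  have "\<delta> * t u < e" using tu e by (simp add: \<delta>_def field_simps)
  obtain U where U: "open U" "0 \<in> U" "\<And>x y. x - y \<in> U \<Longrightarrow> close \<delta> x y"
    using open_nhd_close[OF \<delta>] by blast
  have "((\<lambda>y. y - x) \<longlongrightarrow> x - x) (at x within UNIV)"
    by (rule tendsto_diff[OF tendsto_ident_at tendsto_const])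
  then have "\<forall>\<^sub>F y in at x within UNIV. y - x \<in> U"
    using U by (intro topological_tendstoD) auto
  then show "\<forall>\<^sub>F y in at x within UNIV. dist (t y) (t x) < e"
  proof eventually_elim
    case (elim y)
    then show ?case
      using monotone_hom_close[OF t U(3)] \<open>\<delta> * t u < e\<close> by (force simp: dist_real_def)
  qed
qed

lemma discretisation:
  assumes K: "compact K" and \<delta>: "\<delta> > 0"
  obtains A g where "finite A" "g \<in> borel \<rightarrow>\<^sub>M count_space UNIV" "range g \<subseteq> A" "\<And>x. x \<in> K \<Longrightarrow> close \<delta> x (g x)"
proof -
  obtain U where U: "open U" "0 \<in> U" "\<And>x y. x - y \<in> U \<Longrightarrow> close \<delta> x y"
    using open_nhd_close[OF \<delta>] by blast
  have open_shift: "open ((\<lambda>x. x - a) -` U)" for a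
    by (intro open_vimage U continuous_intros)
  obtain C where C: "C \<subseteq> K" "finite C" "K \<subseteq> (\<Union>a\<in>C. (\<lambda>x. x - a) -` U)"
    by (rule compactE_image[OF K, of K "\<lambda>a. (\<lambda>x. x - a) -` U"]) (use open_shift U(2) in auto)
  \<comment> \<open>Centres are added one at a time, each overriding the earlier choice on its own
    open translate; points outside all translates keep the default 0, hence
    \<open>insert 0 C\<close>.\<close>
  from C(2) have "\<exists>g \<in> borel \<rightarrow>\<^sub>M count_space UNIV. range g \<subseteq> insert 0 C \<and> (\<forall>a\<in>C. \<forall>x. x - a \<in> U \<longrightarrow> x - g x \<in> U)"
  proof (induction C rule: finite_induct)
    case empty
    then show ?case by (intro bexI[of _ "\<lambda>_. 0"]) auto
  next
    case (insert a C)
    then obtain g where g: "g \<in> borel \<rightarrow>\<^sub>M count_space UNIV" "range g \<subseteq> insert 0 C"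
      "\<forall>a\<in>C. \<forall>x. x - a \<in> U \<longrightarrow> x - g x \<in> U" by blast
    define h where "h x = (if x \<in> (\<lambda>x. x - a) -` U then a else g x)" for x
    have "(\<lambda>x. x - a) -` U \<in> sets borel" using open_shift by (rule borel_open)
    then have "h \<in> borel \<rightarrow>\<^sub>M count_space UNIV"
      unfolding h_def using g(1) by (intro measurable_If_set) auto
    then show ?case using g by (intro bexI[of _ h]) (auto simp: h_def)
  qed
  then obtain g where "g \<in> borel \<rightarrow>\<^sub>M count_space UNIV" "range g \<subseteq> insert 0 C"
    "\<forall>a\<in>C. \<forall>x. x - a \<in> U \<longrightarrow> x - g x \<in> U" by blast
  then show ?thesis using C by (intro that[of "insert 0 C" g] U(3)) auto
qed

end

section \<open>Compactly supported i.i.d. samples\<close>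

text \<open>The complement of the support is a union of null open sets, possibly uncountable. Inner
  regularity reduces to compact subsets, which finitely many of these sets cover.\<close>

lemma radon_measure_support_full:
  fixes \<mu> :: "'a::topological_space measure"
  assumes "radon_measure \<mu>"
  shows "emeasure \<mu> (- measure_support \<mu>) = 0"
proof -
  interpret finite_measure \<mu> using assms by (simp add: radon_measure_def)
  have sets: "sets \<mu> = sets borel" and
    inner: "\<And>A. A \<in> sets borel \<Longrightarrow> emeasure \<mu> A = (SUP K\<in>{K. compact K \<and> K \<subseteq> A}. emeasure \<mu> K)"
    using assms by (auto simp: radon_measure_def)
  have space: "space \<mu> = UNIV" using sets_eq_imp_space_eq[OF sets] by simp
  define \<U> where "\<U> = {U. open U \<and> emeasure \<mu> U = 0}"
  have "emeasure \<mu> K \<le> 0" if K: "compact K" "K \<subseteq> - measure_support \<mu>" for K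
  proof -
    have "\<exists>U\<in>\<U>. x \<in> U" if "x \<in> K" for x
    proof -
      from that K(2) obtain F where F: "closed F" "emeasure \<mu> F = emeasure \<mu> (space \<mu>)" "x \<notin> F"
        by (auto simp: measure_support_def)
      have "emeasure \<mu> (space \<mu> - F) = 0"
        using F sets by (subst emeasure_compl) auto
      then show ?thesis using F by (intro bexI[of _ "- F"]) (auto simp: \<U>_def space Compl_eq_Diff_UNIV)
    qed
    then have "K \<subseteq> \<Union>\<U>" by blast
    then obtain \<V> where \<V>: "\<V> \<subseteq> \<U>" "finite \<V>" "K \<subseteq> \<Union>\<V>"
      by (rule compactE[OF K(1)]) (auto simp: \<U>_def)
    have "emeasure \<mu> K \<le> emeasure \<mu> (\<Union>\<V>)"
      using \<V> sets by (intro emeasure_mono) (auto simp: \<U>_def intro!: borel_open open_Union)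
    also have "\<dots> \<le> (\<Sum>U\<in>\<V>. emeasure \<mu> U)"
      using emeasure_subadditive_finite[OF \<V>(2), of "\<lambda>U. U" \<mu>] \<V>(1) sets
      by (auto simp: \<U>_def subset_iff)
    also have "\<dots> = 0" using \<V>(1) by (intro sum.neutral) (auto simp: \<U>_def)
    finally show ?thesis .
  qed
  then have "(SUP K\<in>{K. compact K \<and> K \<subseteq> - measure_support \<mu>}. emeasure \<mu> K) \<le> 0"
    by (intro SUP_least) simp
  moreover have "- measure_support \<mu> \<in> sets borel"
    unfolding measure_support_def by (intro borel_open open_Compl closed_Inter) auto
  ultimately show ?thesis by (simp only: inner le_zero_eq)
qed

lemma AE_in_measure_support:
  fixes X :: "'w \<Rightarrow> 'a::topological_space"
  assumes "radon_rv M X"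
  shows "AE \<omega> in M. X \<omega> \<in> measure_support (distr M borel X)"
proof -
  let ?S = "measure_support (distr M borel X)"
  have X: "X \<in> borel_measurable M" and "radon_measure (distr M borel X)"
    using assms by (auto simp: radon_rv_def)
  have "closed ?S" unfolding measure_support_def by (intro closed_Inter) auto
  then have "AE x in distr M borel X. x \<in> ?S"
    using radon_measure_support_full[OF \<open>radon_measure _\<close>]
    by (intro AE_I[of _ _ "- ?S"]) auto
  then show ?thesis using \<open>closed ?S\<close> by (subst (asm) AE_distr_iff[OF X]) auto
qed

text \<open>The tuple is Borel for the product topology by the last conjunct of
  \<open>iid_copies\<close>, and summing coordinates is continuous. Measurability of the separate
  \<open>Xs i\<close> would not give this when the Borel sets of the product exceed the product
  sigma-algebra.\<close>

lemma iid_copies_sum_measurable: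
  fixes X :: "'w \<Rightarrow> 'v::real_tvs"
  assumes "iid_copies M X Xs"
  shows "(\<lambda>\<omega>. \<Sum>i=1..n. Xs i \<omega>) \<in> borel_measurable M"
proof -
  have T: "(\<lambda>\<omega>. \<lambda>i\<in>{1..n}. Xs i \<omega>) \<in> borel_measurable M"
    using assms by (auto simp: iid_copies_def radon_rv_def)
  have "continuous_on UNIV (\<lambda>f::nat \<Rightarrow> 'v. \<Sum>i=1..n. f i)"
    by (intro continuous_intros continuous_on_product_coordinates)
  then have "(\<lambda>f::nat \<Rightarrow> 'v. \<Sum>i=1..n. f i) \<in> borel_measurable borel"
    by (rule borel_measurable_continuous_onI)
  from measurable_compose[OF T this] show ?thesis by simp
qed

lemma exp_le_quadratic:
  fixes x :: real
  assumes "\<bar>x\<bar> \<le> 1"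
  shows "exp x \<le> 1 + x + x\<^sup>2"
proof (cases "x \<ge> 0")
  case True
  then show ?thesis using exp_bound[of x] assms by simp
next
  case False
  define y where "y = - x"
  have y: "y > 0" using False by (simp add: y_def)
  have pos: "1 - y + y\<^sup>2 \<ge> 0" using zero_le_power2[of "y - 1/2"] by (simp add: power2_eq_square algebra_simps)
  \<comment> \<open>The right-hand side equals \<open>1 + y ^ 3\<close>.\<close>
  have "1 \<le> (1 - y + y\<^sup>2) * (1 + y)"
    using y by (simp add: power2_eq_square algebra_simps)
  also have "\<dots> \<le> (1 - y + y\<^sup>2) * exp y"
    using exp_ge_add_one_self[of y] pos by (intro mult_left_mono) auto
  finally have "exp (- y) \<le> 1 - y + y\<^sup>2" by (simp add: exp_minus field_simps)
  then show ?thesis by (simp add: y_def)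
qed

text \<open>The Radon and support hypotheses are distilled into almost sure membership in a compact
  set and Borel measurability of partial sums.\<close>

locale iid_sample = prob_space M for M :: "'a measure" +
  fixes X :: "'a \<Rightarrow> 'v::real_tvs" and Xs :: "nat \<Rightarrow> 'a \<Rightarrow> 'v" and K :: "'v set"
  assumes compact_K: "compact K" and X_in_K: "AE \<omega> in M. X \<omega> \<in> K"
    and X_measurable [measurable]: "X \<in> borel_measurable M"
    and indep: "indep_vars (\<lambda>_. borel) Xs UNIV"
    and distr_eq: "distr M borel (Xs i) = distr M borel X"
    and sum_measurable [measurable]: "(\<lambda>\<omega>. \<Sum>i=1..n. Xs i \<omega>) \<in> borel_measurable M"
begin

lemma Xs_measurable [measurable]: "Xs i \<in> borel_measurable M"
  using indep by (auto simp: indep_vars_def)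

lemma Xs_in_K: "AE \<omega> in M. \<forall>i. Xs i \<omega> \<in> K"
proof (subst AE_all_countable, intro allI)
  fix i
  have K: "{x \<in> space borel. x \<in> K} \<in> sets borel" using compact_imp_closed[OF compact_K] by simp
  have "AE x in distr M borel (Xs i). x \<in> K"
    unfolding distr_eq by (subst AE_distr_iff[OF X_measurable K]) (rule X_in_K)
  then show "AE \<omega> in M. Xs i \<omega> \<in> K" by (subst (asm) AE_distr_iff[OF Xs_measurable K])
qed

lemma prob_Xs_eq: "B \<in> sets borel \<Longrightarrow> prob {\<omega> \<in> space M. Xs i \<omega> \<in> B} = prob {\<omega> \<in> space M. X \<omega> \<in> B}"
  using measure_distr[OF Xs_measurable, of B i] measure_distr[OF X_measurable, of B]
  by (simp add: distr_eq vimage_def Int_def conj_commute)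

lemma expectation_prod:
  fixes h :: "'v \<Rightarrow> real"
  assumes h [measurable]: "h \<in> borel_measurable borel" and int: "integrable M (\<lambda>\<omega>. h (X \<omega>))"
  shows "integrable M (\<lambda>\<omega>. \<Prod>i=1..n. h (Xs i \<omega>))"
    and "expectation (\<lambda>\<omega>. \<Prod>i=1..n. h (Xs i \<omega>)) = expectation (\<lambda>\<omega>. h (X \<omega>)) ^ n"
proof -
  have ind: "indep_vars (\<lambda>_. borel) (\<lambda>i \<omega>. h (Xs i \<omega>)) {1..n}"
    by (rule indep_vars_subset[OF indep_vars_compose2[OF indep]]) auto
  have int_i: "integrable M (\<lambda>\<omega>. h (Xs i \<omega>))" for i
    using int integrable_distr_eq[OF Xs_measurable h, of i] integrable_distr_eq[OF X_measurable h]
    by (simp add: distr_eq)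
  have eq: "expectation (\<lambda>\<omega>. h (Xs i \<omega>)) = expectation (\<lambda>\<omega>. h (X \<omega>))" for i
    using integral_distr[OF Xs_measurable h, of i] integral_distr[OF X_measurable h]
    by (simp add: distr_eq)
  show "integrable M (\<lambda>\<omega>. \<Prod>i=1..n. h (Xs i \<omega>))"
    by (rule indep_vars_integrable[OF _ ind int_i]) auto
  show "expectation (\<lambda>\<omega>. \<Prod>i=1..n. h (Xs i \<omega>)) = expectation (\<lambda>\<omega>. h (X \<omega>)) ^ n"
    using indep_vars_lebesgue_integral[OF _ ind int_i] by (simp add: eq)
qed

text \<open>The side conditions on \<open>Xs j\<close> for \<open>j \<in> J\<close> make the induction on \<open>n\<close> go through without
  independence of partial sums, which is only available for tuples.\<close>

lemma prob_sum_discretised_joint: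
  fixes g :: "'v \<Rightarrow> 'v" and x :: 'v and P :: "'v set"
  assumes A: "finite A" and g [measurable]: "g \<in> borel \<rightarrow>\<^sub>M count_space UNIV" and gA: "range g \<subseteq> A"
    and J: "finite J" "J \<inter> {1..n} = {}" and B: "\<And>j. j \<in> J \<Longrightarrow> B j \<in> sets borel"
  defines "E \<equiv> {\<omega> \<in> space M. (\<forall>j\<in>J. Xs j \<omega> \<in> B j) \<and> (\<Sum>i=1..n. g (Xs i \<omega>)) - x \<in> P}"
  shows "E \<in> events \<and> prob E = (\<Prod>j\<in>J. prob {\<omega> \<in> space M. X \<omega> \<in> B j}) *
      tail_weight P A (\<lambda>a. prob {\<omega> \<in> space M. g (X \<omega>) = a}) n x"
  using J B unfolding E_def
proof (induction n arbitrary: J B x)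
  case 0
  have meas: "{\<omega> \<in> space M. \<forall>j\<in>J. Xs j \<omega> \<in> B j} \<in> events"
  proof (rule sets.sets_Collect_finite_All)
    show "{\<omega> \<in> space M. Xs j \<omega> \<in> B j} \<in> events" if "j \<in> J" for j
      using measurable_sets[OF Xs_measurable 0(3)[OF that]] by (simp add: vimage_def Int_def conj_commute)
  qed (use 0 in auto)
  have "prob {\<omega> \<in> space M. \<forall>j\<in>J. Xs j \<omega> \<in> B j} = (\<Prod>j\<in>J. prob {\<omega> \<in> space M. X \<omega> \<in> B j})"
  proof (cases "J = {}")
    case True
    then show ?thesis by (simp add: prob_space)
  next
    case False
    have "{\<omega> \<in> space M. \<forall>j\<in>J. Xs j \<omega> \<in> B j} = (\<Inter>j\<in>J. Xs j -` B j \<inter> space M)" using False by auto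
    also have "prob \<dots> = (\<Prod>j\<in>J. prob (Xs j -` B j \<inter> space M))"
      using False 0 by (intro indep_varsD[OF indep]) auto
    also have "\<dots> = (\<Prod>j\<in>J. prob {\<omega> \<in> space M. Xs j \<omega> \<in> B j})"
      by (simp add: vimage_def Int_def conj_commute)
    also have "\<dots> = (\<Prod>j\<in>J. prob {\<omega> \<in> space M. X \<omega> \<in> B j})"
      using 0 by (intro prod.cong prob_Xs_eq) auto
    finally show ?thesis .
  qed
  then show ?case using meas by (cases "- x \<in> P") auto
next
  case (Suc n)
  let ?w = "\<lambda>a. prob {\<omega> \<in> space M. g (X \<omega>) = a}"
  let ?J = "insert (Suc n) J"
  \<comment> \<open>Conditioning on the rounded value \<open>a\<close> of the last draw becomes one
    more side condition, to which the induction hypothesis applies with target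
    \<open>x - a\<close>.\<close>
  let ?B = "\<lambda>a. B(Suc n := g -` {a})"
  define F where "F a = {\<omega> \<in> space M. (\<forall>j\<in>?J. Xs j \<omega> \<in> ?B a j) \<and> (\<Sum>i=1..n. g (Xs i \<omega>)) - (x - a) \<in> P}" for a
  define p where "p = (\<Prod>j\<in>J. prob {\<omega> \<in> space M. X \<omega> \<in> B j})"
  have notin: "Suc n \<notin> J" using Suc.prems(2) by auto
  have g_vimage: "g -` {a} \<in> sets borel" for a
    using measurable_sets[OF g, of "{a}"] by simp
  have IH: "F a \<in> events \<and> prob (F a) = p * ?w a * tail_weight P A ?w n (x - a)" for a
  proof -
    have prod: "(\<Prod>j\<in>?J. prob {\<omega> \<in> space M. X \<omega> \<in> ?B a j}) = p * ?w a"
      using notin Suc.prems(1) unfolding p_def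
      by (subst prod.insert) (auto simp: vimage_def mult.commute intro!: prod.cong)
    show ?thesis
      unfolding F_def prod[symmetric]
      using Suc.prems g_vimage by (intro Suc.IH) auto
  qed
  have eq: "{\<omega> \<in> space M. (\<forall>j\<in>J. Xs j \<omega> \<in> B j) \<and> (\<Sum>i=1..Suc n. g (Xs i \<omega>)) - x \<in> P} = (\<Union>a\<in>A. F a)"
    using gA notin by (auto simp: F_def algebra_simps)
  have "disjoint_family_on F A"
    by (auto simp: disjoint_family_on_def F_def)
  then have "prob (\<Union>a\<in>A. F a) = (\<Sum>a\<in>A. prob (F a))"
    using IH by (intro finite_measure_finite_Union A) auto
  also have "\<dots> = p * tail_weight P A ?w (Suc n) x"
    using IH by (simp add: sum_distrib_left mult.assoc)
  finally show ?case using IH A unfolding eq p_def by (auto intro: sets.finite_UN)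
qed

lemma prob_sum_discretised:
  fixes g :: "'v \<Rightarrow> 'v" and x :: 'v
  assumes "finite A" and "g \<in> borel \<rightarrow>\<^sub>M count_space UNIV" and "range g \<subseteq> A"
  shows "{\<omega> \<in> space M. (\<Sum>i=1..n. g (Xs i \<omega>)) - x \<in> P} \<in> events"
    and "prob {\<omega> \<in> space M. (\<Sum>i=1..n. g (Xs i \<omega>)) - x \<in> P} =
      tail_weight P A (\<lambda>a. prob {\<omega> \<in> space M. g (X \<omega>) = a}) n x"
  using prob_sum_discretised_joint[OF assms, of "{}" n] by auto

lemma finite_weights_discretised:
  fixes g :: "'v \<Rightarrow> 'v"
  assumes A: "finite A" and g [measurable]: "g \<in> borel \<rightarrow>\<^sub>M count_space UNIV" and gA: "range g \<subseteq> A"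
  shows "finite_weights A (\<lambda>a. prob {\<omega> \<in> space M. g (X \<omega>) = a})"
proof
  have "prob (\<Union>a\<in>A. {\<omega> \<in> space M. g (X \<omega>) = a}) = (\<Sum>a\<in>A. prob {\<omega> \<in> space M. g (X \<omega>) = a})"
    by (intro finite_measure_finite_Union A) (auto simp: disjoint_family_on_def)
  moreover have "(\<Union>a\<in>A. {\<omega> \<in> space M. g (X \<omega>) = a}) = space M" using gA by auto
  ultimately show "(\<Sum>a\<in>A. prob {\<omega> \<in> space M. g (X \<omega>) = a}) = 1" by (simp add: prob_space)
qed (simp_all add: A)

end

section \<open>Exponential moments, Chernoff bounds and Cramer's lower bound on half-spaces\<close>

locale ordered_iid_sample = order_unit_cone_tvs P u + iid_sample M X Xs K
  for P :: "'v::real_tvs set" and u and M :: "'a measure" and X :: "'a \<Rightarrow> 'v" and Xs K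
begin

definition mgf :: "('v \<Rightarrow> real) \<Rightarrow> real" where
  "mgf t = expectation (\<lambda>\<omega>. exp (t (X \<omega>)))"

lemma monotone_hom_measurable: "t \<in> monotone_homs P \<Longrightarrow> t \<in> borel_measurable borel"
  by (intro borel_measurable_continuous_onI monotone_hom_continuous)

lemma monotone_hom_bounded:
  assumes "t \<in> monotone_homs P"
  obtains B where "B \<ge> 0" "AE \<omega> in M. \<bar>t (X \<omega>)\<bar> \<le> B"
proof -
  have "bounded (t ` K)"
    by (intro compact_imp_bounded compact_continuous_image compact_K
      continuous_on_subset[OF monotone_hom_continuous[OF assms]]) auto
  then obtain B where B: "\<And>x. x \<in> K \<Longrightarrow> \<bar>t x\<bar> \<le> B" by (auto simp: bounded_iff)
  show ?thesis
  proof (rule that[of "max B 0"])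
    show "AE \<omega> in M. \<bar>t (X \<omega>)\<bar> \<le> max B 0"
      using X_in_K by eventually_elim (use B in \<open>auto simp: le_max_iff_disj\<close>)
  qed simp
qed

lemma integrable_exp_hom:
  assumes t: "t \<in> monotone_homs P"
  shows "integrable M (\<lambda>\<omega>. exp (t (X \<omega>)))"
proof -
  note [measurable] = monotone_hom_measurable[OF t]
  obtain B where B: "AE \<omega> in M. \<bar>t (X \<omega>)\<bar> \<le> B" using monotone_hom_bounded[OF t] by blast
  show ?thesis
  proof (rule integrable_const_bound)
    show "AE \<omega> in M. norm (exp (t (X \<omega>))) \<le> exp B"
      using B by eventually_elim auto
  qed measurable
qed

lemma mgf_pos:
  assumes t: "t \<in> monotone_homs P"
  shows "mgf t > 0"
proof -
  obtain B where B: "AE \<omega> in M. \<bar>t (X \<omega>)\<bar> \<le> B" using monotone_hom_bounded[OF t] by blast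
  have "expectation (\<lambda>_. exp (- B)) \<le> mgf t"
    unfolding mgf_def
  proof (rule integral_mono_AE)
    show "AE \<omega> in M. exp (- B) \<le> exp (t (X \<omega>))" using B by eventually_elim auto
  qed (auto intro: integrable_exp_hom t)
  then have "exp (- B) \<le> mgf t" by (simp add: prob_space)
  then show ?thesis by (rule less_le_trans[OF exp_gt_zero])
qed

lemma mgf_sum:
  assumes t: "t \<in> monotone_homs P"
  shows "integrable M (\<lambda>\<omega>. exp (t (\<Sum>i=1..n. Xs i \<omega>)))"
    and "expectation (\<lambda>\<omega>. exp (t (\<Sum>i=1..n. Xs i \<omega>))) = mgf t ^ n"
proof -
  note [measurable] = monotone_hom_measurable[OF t]
  have "Modules.additive t" using t by (simp add: monotone_homs_def)
  then have eq: "exp (t (\<Sum>i=1..n. Xs i \<omega>)) = (\<Prod>i=1..n. exp (t (Xs i \<omega>)))" for \<omega>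
    by (simp add: additive.sum exp_sum)
  have "(\<lambda>x. exp (t x)) \<in> borel_measurable borel" by measurable
  from expectation_prod[OF this integrable_exp_hom[OF t], of n]
  show "integrable M (\<lambda>\<omega>. exp (t (\<Sum>i=1..n. Xs i \<omega>)))"
    and "expectation (\<lambda>\<omega>. exp (t (\<Sum>i=1..n. Xs i \<omega>))) = mgf t ^ n"
    by (simp_all only: eq mgf_def)
qed

text \<open>Markov's inequality for the exponential of \<open>t\<close> of the sum. An arbitrary
  event is allowed so that both half-spaces and orthants are covered.\<close>

lemma chernoff:
  assumes t: "t \<in> monotone_homs P" and E: "E \<in> events"
    and b: "\<And>\<omega>. \<omega> \<in> E \<Longrightarrow> b \<le> t (\<Sum>i=1..n. Xs i \<omega>)"
  shows "prob E \<le> mgf t ^ n * exp (- b)"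
proof -
  have "exp b * prob E = expectation (\<lambda>\<omega>. exp b * indicator E \<omega>)"
    using E by simp
  also have "\<dots> \<le> expectation (\<lambda>\<omega>. exp (t (\<Sum>i=1..n. Xs i \<omega>)))"
  proof (rule integral_mono)
    show "integrable M (\<lambda>\<omega>. exp b * indicator E \<omega>)"
      using E by (intro integrable_mult_right integrable_real_indicator) (auto simp: less_top[symmetric])
    show "exp b * indicator E \<omega> \<le> exp (t (\<Sum>i=1..n. Xs i \<omega>))" for \<omega>
      using b[of \<omega>] by (cases "\<omega> \<in> E") auto
  qed (rule mgf_sum[OF t])
  finally have "exp b * prob E \<le> mgf t ^ n" unfolding mgf_sum(2)[OF t] .
  then show ?thesis by (simp add: exp_minus field_simps)
qed

text \<open>Replaces differentiating the logarithmic moment generating function at \<open>t\<close>.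
  The coefficient of \<open>s\<close> is the mean of \<open>t X\<close> under the tilted law, and
  boundedness of \<open>t X\<close> controls the second-order remainder.\<close>

lemma mgf_tilt_le:
  assumes t: "t \<in> monotone_homs P" and B: "AE \<omega> in M. \<bar>t (X \<omega>)\<bar> \<le> B" and s: "\<bar>s\<bar> \<le> 1" "\<bar>s\<bar> * B \<le> 1"
  shows "mgf (\<lambda>x. (1 + s) * t x) \<le>
    mgf t * exp (s * (expectation (\<lambda>\<omega>. t (X \<omega>) * exp (t (X \<omega>))) / mgf t) + (s * B)\<^sup>2)"
proof -
  note [measurable] = monotone_hom_measurable[OF t]
  let ?m = "expectation (\<lambda>\<omega>. t (X \<omega>) * exp (t (X \<omega>)))"
  have int1: "integrable M (\<lambda>\<omega>. exp (t (X \<omega>)))" by (rule integrable_exp_hom[OF t])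
  have int2: "integrable M (\<lambda>\<omega>. t (X \<omega>) * exp (t (X \<omega>)))"
  proof (rule integrable_const_bound)
    show "AE \<omega> in M. norm (t (X \<omega>) * exp (t (X \<omega>))) \<le> B * exp B"
      using B by eventually_elim (auto simp: abs_mult intro!: mult_mono)
  qed measurable
  have ptw: "AE \<omega> in M. exp ((1 + s) * t (X \<omega>)) \<le> (1 + (s * B)\<^sup>2) * exp (t (X \<omega>)) + s * (t (X \<omega>) * exp (t (X \<omega>)))"
    using B
  proof eventually_elim
    case (elim \<omega>)
    have le: "\<bar>s * t (X \<omega>)\<bar> \<le> \<bar>s\<bar> * B" unfolding abs_mult using elim by (intro mult_left_mono) auto
    then have "exp (s * t (X \<omega>)) \<le> 1 + s * t (X \<omega>) + (s * t (X \<omega>))\<^sup>2"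
      using s by (intro exp_le_quadratic) linarith
    also have "(s * t (X \<omega>))\<^sup>2 \<le> (s * B)\<^sup>2"
      using power_mono[OF le, of 2] by (simp add: power_mult_distrib)
    finally have "exp (t (X \<omega>)) * exp (s * t (X \<omega>)) \<le> exp (t (X \<omega>)) * (1 + s * t (X \<omega>) + (s * B)\<^sup>2)"
      by (intro mult_left_mono) auto
    then show ?case by (simp add: algebra_simps flip: exp_add)
  qed
  have "mgf (\<lambda>x. (1 + s) * t x) \<le> expectation (\<lambda>\<omega>. (1 + (s * B)\<^sup>2) * exp (t (X \<omega>)) + s * (t (X \<omega>) * exp (t (X \<omega>))))"
    unfolding mgf_def using s ptw int1 int2
    by (intro integral_mono_AE integrable_exp_hom monotone_homs_scale t Bochner_Integration.integrable_add integrable_mult_right) auto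
  also have "\<dots> = (1 + (s * B)\<^sup>2) * mgf t + s * ?m"
    using int1 int2 by (simp add: mgf_def)
  also have "\<dots> = mgf t * (1 + (s * (?m / mgf t) + (s * B)\<^sup>2))"
    using mgf_pos[OF t] by (simp add: field_simps)
  also have "\<dots> \<le> mgf t * exp (s * (?m / mgf t) + (s * B)\<^sup>2)"
    using mgf_pos[OF t] exp_ge_add_one_self by (intro mult_left_mono) auto
  finally show ?thesis .
qed

text \<open>The mean \<open>a\<close> of the tilted law is where the rate function is \<open>a - ln (mgf t)\<close>. Both deviations
  from \<open>a\<close> under the tilted law are exponentially small by Chernoff bounds at \<open>(1 \<plusminus> s) t\<close>.\<close>

lemma cramer_lower_halfspace:
  assumes t: "t \<in> monotone_homs P"
  obtains a where "\<And>\<delta>. \<delta> > 0 \<Longrightarrow> \<forall>\<^sub>F n in sequentially.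
    mgf t ^ n * exp (- real n * (a + \<delta>)) / 2 \<le> prob {\<omega> \<in> space M. real n * (a - \<delta>) \<le> t (\<Sum>i=1..n. Xs i \<omega>)}"
proof -
  note [measurable] = monotone_hom_measurable[OF t]
  define a where "a = expectation (\<lambda>\<omega>. t (X \<omega>) * exp (t (X \<omega>))) / mgf t"
  obtain B0 where B0: "B0 \<ge> 0" "AE \<omega> in M. \<bar>t (X \<omega>)\<bar> \<le> B0" using monotone_hom_bounded[OF t] by blast
  define B where "B = B0 + 1"
  have B: "B \<ge> 1" "AE \<omega> in M. \<bar>t (X \<omega>)\<bar> \<le> B"
    using B0 by (auto simp: B_def)
  show ?thesis
  proof (rule that[of a])
    fix \<delta> :: real assume \<delta>: "\<delta> > 0"
    \<comment> \<open>The first entry admits the quadratic estimate of \<open>exp\<close>, the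
      second makes its remainder at most half of \<open>s * \<delta>\<close>.\<close>
    define s where "s = min (1 / B) (\<delta> / (2 * B\<^sup>2))"
    have s: "s > 0" "s * B \<le> 1" "(s * B)\<^sup>2 \<le> s * \<delta> / 2"
    proof -
      show "s > 0" using B \<delta> by (simp add: s_def)
      have "s \<le> 1 / B" "s \<le> \<delta> / (2 * B\<^sup>2)" by (simp_all add: s_def)
      then have "s * B \<le> 1" "s * B\<^sup>2 \<le> \<delta> / 2" using B by (simp_all add: field_simps)
      then show "s * B \<le> 1" "(s * B)\<^sup>2 \<le> s * \<delta> / 2"
        using mult_left_mono[of "s * B\<^sup>2" "\<delta> / 2" s] \<open>s > 0\<close>
        by (simp_all add: power_mult_distrib power2_eq_square algebra_simps)
    qed
    have s1: "s \<le> 1" using s(1,2) B(1) mult_left_mono[of 1 B s] by linarith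
    \<comment> \<open>Both the remainder and the resulting decay rate: a deviation by \<delta> gains
      \<open>s * \<delta>\<close> in the exponent, of which the remainder takes back at most
      half.\<close>
    define r where "r = s * \<delta> / 2"
    have r: "r > 0" using s \<delta> by (simp add: r_def)
    have tilt: "mgf (\<lambda>x. (1 + \<sigma>) * t x) \<le> mgf t * exp (\<sigma> * a + r)" if "\<bar>\<sigma>\<bar> = s" for \<sigma>
    proof -
      have "mgf (\<lambda>x. (1 + \<sigma>) * t x) \<le> mgf t * exp (\<sigma> * a + (\<sigma> * B)\<^sup>2)"
        unfolding a_def using that s s1 by (intro mgf_tilt_le t B) auto
      also have "(\<sigma> * B)\<^sup>2 = (s * B)\<^sup>2" using that by (auto simp: power_mult_distrib simp flip: that)
      finally show ?thesis
        using s(3) mgf_pos[OF t] by (auto simp: r_def elim!: order_trans)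
    qed
    have hom: "(\<lambda>x. (1 + \<sigma>) * t x) \<in> monotone_homs P" if "\<bar>\<sigma>\<bar> = s" for \<sigma>
      using that s1 by (intro monotone_homs_scale t) linarith
    have main: "mgf t ^ n * exp (- real n * (a + \<delta>)) * (1 - 2 * exp (- real n * r))
        \<le> prob {\<omega> \<in> space M. real n * (a - \<delta>) \<le> t (\<Sum>i=1..n. Xs i \<omega>)}" for n
    proof -
      define S where "S \<omega> = t (\<Sum>i=1..n. Xs i \<omega>)" for \<omega>
      have S [measurable]: "S \<in> borel_measurable M" unfolding S_def by measurable
      define E where "E = {\<omega> \<in> space M. real n * (a - \<delta>) \<le> S \<omega>}"
      have E [measurable]: "E \<in> events" unfolding E_def by measurable
      have int: "integrable M (\<lambda>\<omega>. exp ((1 + \<sigma>) * S \<omega>))"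
        and mgf_le: "expectation (\<lambda>\<omega>. exp ((1 + \<sigma>) * S \<omega>)) \<le> (mgf t * exp (\<sigma> * a + r)) ^ n"
        if "\<bar>\<sigma>\<bar> = s" for \<sigma>
      proof -
        show "integrable M (\<lambda>\<omega>. exp ((1 + \<sigma>) * S \<omega>))"
          using mgf_sum(1)[OF hom[OF that], of n] by (simp add: S_def)
        have "expectation (\<lambda>\<omega>. exp ((1 + \<sigma>) * S \<omega>)) = mgf (\<lambda>x. (1 + \<sigma>) * t x) ^ n"
          using mgf_sum(2)[OF hom[OF that], of n] by (simp add: S_def)
        also have "\<dots> \<le> (mgf t * exp (\<sigma> * a + r)) ^ n"
          using mgf_pos[OF hom[OF that]] by (intro power_mono tilt that) simp
        finally show "expectation (\<lambda>\<omega>. exp ((1 + \<sigma>) * S \<omega>)) \<le> (mgf t * exp (\<sigma> * a + r)) ^ n" .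
      qed
      \<comment> \<open>The three terms dominate \<open>exp (S \<omega>)\<close> on the window,
        above it and below it. Integrating this bound under the original measure spares the
        construction of the tilted one.\<close>
      let ?f = "\<lambda>\<omega>. exp (real n * (a + \<delta>)) * indicator E \<omega>
        + exp (- s * (real n * (a + \<delta>))) * exp ((1 + s) * S \<omega>)
        + exp (s * (real n * (a - \<delta>))) * exp ((1 + - s) * S \<omega>)"
      have "mgf t ^ n = expectation (\<lambda>\<omega>. exp (S \<omega>))"
        using mgf_sum(2)[OF t] by (simp add: S_def)
      also have "\<dots> \<le> expectation ?f"
      proof (rule integral_mono)
        show "integrable M (\<lambda>\<omega>. exp (S \<omega>))" using mgf_sum(1)[OF t] by (simp add: S_def)
        show "integrable M ?f"
          using s by (intro Bochner_Integration.integrable_add integrable_mult_right int integrable_real_indicator)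
            (auto simp: less_top[symmetric])
        fix \<omega> assume \<omega>: "\<omega> \<in> space M"
        consider "S \<omega> < real n * (a - \<delta>)" | "\<omega> \<in> E" "S \<omega> \<le> real n * (a + \<delta>)" | "S \<omega> > real n * (a + \<delta>)"
          using \<omega> by (fastforce simp: E_def)
        then show "exp (S \<omega>) \<le> ?f \<omega>"
        proof cases
          case 1
          then have "s * S \<omega> \<le> s * (real n * (a - \<delta>))" using s by (intro mult_left_mono) auto
          then have "S \<omega> \<le> s * (real n * (a - \<delta>)) + (1 + - s) * S \<omega>" by (simp add: algebra_simps)
          then have "exp (S \<omega>) \<le> exp (s * (real n * (a - \<delta>))) * exp ((1 + - s) * S \<omega>)"
            by (simp only: exp_le_cancel_iff flip: exp_add)
          then show ?thesis by (smt (verit) exp_ge_zero indicator_pos_le mult_nonneg_nonneg)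
        next
          case 2
          then have "exp (S \<omega>) \<le> exp (real n * (a + \<delta>)) * indicator E \<omega>" by simp
          then show ?thesis by (smt (verit) exp_ge_zero mult_nonneg_nonneg)
        next
          case 3
          then have "s * (real n * (a + \<delta>)) \<le> s * S \<omega>" using s by (intro mult_left_mono) auto
          then have "S \<omega> \<le> - s * (real n * (a + \<delta>)) + (1 + s) * S \<omega>" by (simp add: algebra_simps)
          then have "exp (S \<omega>) \<le> exp (- s * (real n * (a + \<delta>))) * exp ((1 + s) * S \<omega>)"
            by (simp only: exp_le_cancel_iff flip: exp_add)
          then show ?thesis by (smt (verit) exp_ge_zero indicator_pos_le mult_nonneg_nonneg)
        qed
      qed
      also have "\<dots> = exp (real n * (a + \<delta>)) * prob E
        + exp (- s * (real n * (a + \<delta>))) * expectation (\<lambda>\<omega>. exp ((1 + s) * S \<omega>))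
        + exp (s * (real n * (a - \<delta>))) * expectation (\<lambda>\<omega>. exp ((1 + - s) * S \<omega>))"
        using int[of s] int[of "- s"] s by (simp add: integrable_real_indicator less_top[symmetric])
      also have "\<dots> \<le> exp (real n * (a + \<delta>)) * prob E
        + exp (- s * (real n * (a + \<delta>))) * (mgf t * exp (s * a + r)) ^ n
        + exp (s * (real n * (a - \<delta>))) * (mgf t * exp (- s * a + r)) ^ n"
        using mgf_le[of s] mgf_le[of "- s"] s by (intro add_mono mult_left_mono) auto
      also have "exp (- s * (real n * (a + \<delta>))) * (mgf t * exp (s * a + r)) ^ n = mgf t ^ n * exp (- real n * r)"
        by (simp add: power_mult_distrib exp_of_nat_mult[symmetric] r_def field_simps flip: exp_add)
      also have "exp (s * (real n * (a - \<delta>))) * (mgf t * exp (- s * a + r)) ^ n = mgf t ^ n * exp (- real n * r)"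
        by (simp add: power_mult_distrib exp_of_nat_mult[symmetric] r_def field_simps flip: exp_add)
      finally have "mgf t ^ n * (1 - 2 * exp (- real n * r)) \<le> exp (real n * (a + \<delta>)) * prob E"
        by (simp add: algebra_simps)
      then have "exp (- real n * (a + \<delta>)) * (mgf t ^ n * (1 - 2 * exp (- real n * r)))
          \<le> exp (- real n * (a + \<delta>)) * (exp (real n * (a + \<delta>)) * prob E)"
        by (intro mult_left_mono) auto
      also have "\<dots> = prob E" by (simp add: mult.assoc[symmetric] flip: exp_add)
      finally show ?thesis by (simp add: E_def S_def mult_ac)
    qed
    have "(\<lambda>n. 1 - 2 * exp (- real n * r)) \<longlonglongrightarrow> 1" using r by real_asymp
    then have "\<forall>\<^sub>F n in sequentially. 1 / 2 < 1 - 2 * exp (- real n * r)"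
      by (rule order_tendstoD) simp
    then show "\<forall>\<^sub>F n in sequentially. mgf t ^ n * exp (- real n * (a + \<delta>)) / 2
        \<le> prob {\<omega> \<in> space M. real n * (a - \<delta>) \<le> t (\<Sum>i=1..n. Xs i \<omega>)}"
    proof eventually_elim
      case (elim n)
      have "mgf t ^ n * exp (- real n * (a + \<delta>)) * (1 / 2)
          \<le> mgf t ^ n * exp (- real n * (a + \<delta>)) * (1 - 2 * exp (- real n * r))"
        using elim mgf_pos[OF t] by (intro mult_left_mono) auto
      with main[of n] show ?case by linarith
    qed
  qed
qed

end

section \<open>Comparison of upper tails\<close>

context iid_sample
begin

lemma sum_event:
  assumes f: "continuous_on UNIV f" and D: "closed D"
  shows "{\<omega> \<in> space M. f (\<Sum>i=1..n. Xs i \<omega>) \<in> D} \<in> events"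
proof -
  have "closed (f -` D)" using closed_vimage[OF D f] .
  then have "(\<lambda>\<omega>. \<Sum>i=1..n. Xs i \<omega>) -` (f -` D) \<inter> space M \<in> events"
    by (intro measurable_sets[OF sum_measurable]) auto
  then show ?thesis by (simp add: vimage_def Int_def conj_commute)
qed

lemma average_plus_event:
  "closed D \<Longrightarrow> {\<omega> \<in> space M. (1 / real n) *\<^sub>R (\<Sum>i=1..n. Xs i \<omega>) + y \<in> D} \<in> events"
  by (rule sum_event) (intro continuous_intros continuous_on_scaleR_const)

end

context ordered_iid_sample
begin

lemma average_ge_event: "{\<omega> \<in> space M. (1 / real n) *\<^sub>R (\<Sum>i=1..n. Xs i \<omega>) - y \<in> P} \<in> events"
  using average_plus_event[OF closed_cone, of n "- y"] by simp

lemma mgf_le_discretised: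
  assumes A: "finite A" and g [measurable]: "g \<in> borel \<rightarrow>\<^sub>M count_space UNIV" and gA: "range g \<subseteq> A"
    and g_close: "\<And>x. x \<in> K \<Longrightarrow> close \<delta> x (g x)" and t: "t \<in> monotone_homs P"
  shows "mgf t \<le> exp (\<delta> * t u) * (\<Sum>a\<in>A. prob {\<omega> \<in> space M. g (X \<omega>) = a} * exp (t a))"
proof -
  define S where "S a = {\<omega> \<in> space M. g (X \<omega>) = a}" for a
  have S [measurable]: "S a \<in> events" for a unfolding S_def by measurable
  have int: "integrable M (\<lambda>\<omega>. exp (\<delta> * t u) * (\<Sum>a\<in>A. indicator (S a) \<omega> * exp (t a)))"
    by (intro integrable_mult_right Bochner_Integration.integrable_sum integrable_mult_left integrable_real_indicator)
      (auto simp: less_top[symmetric])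
  have "mgf t \<le> expectation (\<lambda>\<omega>. exp (\<delta> * t u) * (\<Sum>a\<in>A. indicator (S a) \<omega> * exp (t a)))"
    unfolding mgf_def
  proof (rule integral_mono_AE[OF integrable_exp_hom[OF t] int])
    show "AE \<omega> in M. exp (t (X \<omega>)) \<le> exp (\<delta> * t u) * (\<Sum>a\<in>A. indicator (S a) \<omega> * exp (t a))"
      using X_in_K AE_space
    proof eventually_elim
      case (elim \<omega>)
      have "(\<Sum>a\<in>A. indicator (S a) \<omega> * exp (t a)) = (\<Sum>a\<in>A. if g (X \<omega>) = a then exp (t a) else 0)"
        using elim by (intro sum.cong) (auto simp: S_def)
      also have "\<dots> = exp (t (g (X \<omega>)))" using A gA by (subst sum.delta') auto
      finally show ?case
        using monotone_hom_close[OF t g_close[OF elim(1)]] by (simp flip: exp_add)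
    qed
  qed
  also have "\<dots> = exp (\<delta> * t u) * (\<Sum>a\<in>A. prob (S a) * exp (t a))"
    by (subst integral_mult_right_zero, subst Bochner_Integration.integral_sum)
      (auto intro!: integrable_mult_left integrable_real_indicator simp: less_top[symmetric])
  finally show ?thesis by (simp add: S_def)
qed

lemma tail_weight_le_prob_average:
  assumes A: "finite A" and g: "g \<in> borel \<rightarrow>\<^sub>M count_space UNIV" and gA: "range g \<subseteq> A"
    and g_close: "\<And>x. x \<in> K \<Longrightarrow> close \<delta> x (g x)" and n: "n \<ge> 1"
  shows "tail_weight P A (\<lambda>a. prob {\<omega> \<in> space M. g (X \<omega>) = a}) n (real n *\<^sub>R y)
    \<le> prob {\<omega> \<in> space M. (1 / real n) *\<^sub>R (\<Sum>i=1..n. Xs i \<omega>) - (y - \<delta> *\<^sub>R u) \<in> P}"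
  unfolding prob_sum_discretised(2)[OF A g gA, symmetric]
proof (rule finite_measure_mono_AE[OF _ average_ge_event])
  show "AE \<omega> in M. \<omega> \<in> {\<omega> \<in> space M. (\<Sum>i=1..n. g (Xs i \<omega>)) - real n *\<^sub>R y \<in> P} \<longrightarrow>
      \<omega> \<in> {\<omega> \<in> space M. (1 / real n) *\<^sub>R (\<Sum>i=1..n. Xs i \<omega>) - (y - \<delta> *\<^sub>R u) \<in> P}"
    using Xs_in_K
  proof eventually_elim
    case (elim \<omega>)
    let ?x = "(1 / real n) *\<^sub>R (\<Sum>i=1..n. Xs i \<omega>)" and ?y = "(1 / real n) *\<^sub>R (\<Sum>i=1..n. g (Xs i \<omega>))"
    have "close \<delta> ?x ?y" using elim by (intro close_average n g_close) auto
    then have 1: "\<delta> *\<^sub>R u + (?x - ?y) \<in> P" by (simp add: close_def)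
    have "?x - (y - \<delta> *\<^sub>R u) \<in> P" if "(\<Sum>i=1..n. g (Xs i \<omega>)) - real n *\<^sub>R y \<in> P"
    proof -
      have "(1 / real n) *\<^sub>R ((\<Sum>i=1..n. g (Xs i \<omega>)) - real n *\<^sub>R y) \<in> P" using that by (intro scale_pos) auto
      then have "?y - y \<in> P" using n by (simp add: scaleR_diff_right)
      from add_pos[OF 1 this] show ?thesis by (simp add: algebra_simps)
    qed
    then show ?case by auto
  qed
qed

text \<open>One net serves all \<open>n\<close>, so its cardinality disappears from exponential
  rates. Half of \<delta> pays for rounding the sample, half for the net of rounded
  averages.\<close>

lemma finite_net_of_sample_averages:
  assumes \<delta>: "\<delta> > 0"
  obtains Z where "finite Z"
    "\<And>n. n \<ge> 1 \<Longrightarrow> AE \<omega> in M. \<exists>z\<in>Z. close \<delta> ((1 / real n) *\<^sub>R (\<Sum>i=1..n. Xs i \<omega>)) z"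
proof -
  have \<delta>2: "\<delta> / 2 > 0" using \<delta> by simp
  obtain A g where g: "finite A" "range g \<subseteq> A" "\<And>x. x \<in> K \<Longrightarrow> close (\<delta> / 2) x (g x)"
    using discretisation[OF compact_K \<delta>2] by metis
  obtain Z where Z: "finite Z"
    "\<And>n f. n \<ge> 1 \<Longrightarrow> (\<And>i. i \<in> {1..n} \<Longrightarrow> f i \<in> A) \<Longrightarrow>
       \<exists>z\<in>Z. close (\<delta> / 2) ((1 / real n) *\<^sub>R (\<Sum>i=1..n. f i)) z"
    using finite_net_of_averages[OF g(1) \<delta>2] by metis
  show ?thesis
  proof (rule that[OF Z(1)])
    fix n :: nat assume n: "n \<ge> 1"
    show "AE \<omega> in M. \<exists>z\<in>Z. close \<delta> ((1 / real n) *\<^sub>R (\<Sum>i=1..n. Xs i \<omega>)) z"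
      using Xs_in_K
    proof eventually_elim
      case (elim \<omega>)
      obtain z where z: "z \<in> Z" "close (\<delta> / 2) ((1 / real n) *\<^sub>R (\<Sum>i=1..n. g (Xs i \<omega>))) z"
        using Z(2)[OF n, of "\<lambda>i. g (Xs i \<omega>)"] g(2) by auto
      moreover have "close (\<delta> / 2) ((1 / real n) *\<^sub>R (\<Sum>i=1..n. Xs i \<omega>)) ((1 / real n) *\<^sub>R (\<Sum>i=1..n. g (Xs i \<omega>)))"
        using elim by (intro close_average n g) auto
      ultimately have "close (\<delta> / 2 + \<delta> / 2) ((1 / real n) *\<^sub>R (\<Sum>i=1..n. Xs i \<omega>)) z"
        by (blast intro: close_trans)
      then show ?case using z(1) by auto
    qed
  qed
qed

lemma chernoff_average:
  assumes t: "t \<in> monotone_homs P" and n: "n \<ge> 1"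
  shows "prob {\<omega> \<in> space M. (1 / real n) *\<^sub>R (\<Sum>i=1..n. Xs i \<omega>) - y \<in> P} \<le> exp (real n * (ln (mgf t) - t y))"
proof -
  have add: "Modules.additive t" and pos: "\<And>x. x \<in> P \<Longrightarrow> t x \<ge> 0"
    using t by (auto simp: monotone_homs_iff)
  have "prob {\<omega> \<in> space M. (1 / real n) *\<^sub>R (\<Sum>i=1..n. Xs i \<omega>) - y \<in> P} \<le> mgf t ^ n * exp (- (real n * t y))"
  proof (rule chernoff[OF t average_ge_event])
    fix \<omega> assume "\<omega> \<in> {\<omega> \<in> space M. (1 / real n) *\<^sub>R (\<Sum>i=1..n. Xs i \<omega>) - y \<in> P}"
    then have "real n *\<^sub>R ((1 / real n) *\<^sub>R (\<Sum>i=1..n. Xs i \<omega>) - y) \<in> P" by (intro scale_pos) auto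
    then have "t ((\<Sum>i=1..n. Xs i \<omega>) - real n *\<^sub>R y) \<ge> 0"
      using n by (intro pos) (simp add: scaleR_diff_right)
    then show "real n * t y \<le> t (\<Sum>i=1..n. Xs i \<omega>)"
      by (simp add: additive.diff[OF add] additive_scale_nat[OF add])
  qed
  also have "mgf t ^ n = exp (real n * ln (mgf t))"
    using mgf_pos[OF t] by (simp add: exp_of_nat_mult)
  finally show ?thesis by (simp add: algebra_simps flip: exp_add)
qed

end

section \<open>Logarithmic ratios and multiplicative inequalities\<close>

lemma ereal_ln_ereal: "x > 0 \<Longrightarrow> ereal_ln (ereal x) = ereal (ln x)"
  by (simp add: ereal_ln_def)

lemma log_ratio_pos: "p > 0 \<Longrightarrow> q > 0 \<Longrightarrow> log_ratio p q = ereal (ln p - ln q)"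
  by (simp add: log_ratio_def ereal_ln_ereal ln_div)

lemma scaled_log_ratio_le:
  assumes n: "n \<ge> 1" and pq: "p \<ge> 0" "q \<ge> 0" "p \<le> exp (real n * k) * q"
  shows "ereal (1 / real n) * log_ratio p q \<le> ereal k"
proof (cases "p = 0")
  case True
  then have "log_ratio p q = - \<infinity>" by (simp add: log_ratio_def ereal_ln_def zero_ereal_def[symmetric])
  then show ?thesis using n by simp
next
  case False
  then have p: "p > 0" using pq by simp
  then have q: "q > 0" using pq by (cases "q = 0") auto
  have "ln p \<le> ln (exp (real n * k) * q)" using p q pq by (subst ln_le_cancel_iff) auto
  also have "\<dots> = real n * k + ln q" using q by (simp add: ln_mult)
  finally have "(1 / real n) * (ln p - ln q) \<le> k" using n by (simp add: field_simps)
  then show ?thesis using p q by (simp add: log_ratio_pos)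
qed

text \<open>For \<open>p = q = 0\<close> the product inequality holds although
  \<open>log_ratio p q\<close> is \<open>- \<infinity>\<close>; hence the strict bound on
  \<open>p\<close>, which \<open>upset_ratio_lower_bound\<close> supplies.\<close>

lemma scaled_log_ratio_ge:
  assumes n: "n \<ge> 1" and pq: "p > 0" "q \<ge> 0" "exp (real n * k) * q \<le> p"
  shows "ereal k \<le> ereal (1 / real n) * log_ratio p q"
proof (cases "q = 0")
  case True
  then have "log_ratio p q = \<infinity>" using pq by (simp add: log_ratio_def ereal_ln_def divide_ereal_def zero_ereal_def[symmetric])
  then show ?thesis using n by simp
next
  case False
  then have q: "q > 0" using pq by simp
  have "ln (exp (real n * k) * q) \<le> ln p" using q pq by (subst ln_le_cancel_iff) auto
  then have "real n * k + ln q \<le> ln p" using q by (simp add: ln_mult)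
  then have "k \<le> (1 / real n) * (ln p - ln q)" using n by (simp add: field_simps)
  then show ?thesis using pq q by (simp add: log_ratio_pos)
qed

section \<open>Comparison of two samples on half-spaces, orthants and closed upsets\<close>

locale two_ordered_samples =
  X: ordered_iid_sample P u M X Xs K + Y: ordered_iid_sample P u N Y Ys L
  for P :: "'v::real_tvs set" and u and M :: "'a measure" and X :: "'a \<Rightarrow> 'v" and Xs K
    and N :: "'b measure" and Y :: "'b \<Rightarrow> 'v" and Ys L
begin

lemma upset_ratio_lower_bound:
  assumes t: "t \<in> monotone_homs P" and k: "k < ln (X.mgf t) - ln (Y.mgf t)"
  obtains \<epsilon> where "\<epsilon> > 0" "\<forall>\<^sub>F n in sequentially. \<exists>C. closed C \<and> upset P C \<and>
    X.prob {\<omega> \<in> space M. (1 / real n) *\<^sub>R (\<Sum>i=1..n. Xs i \<omega>) \<in> C} > 0 \<and>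
    exp (real n * k) * Y.prob {\<omega> \<in> space N. (1 / real n) *\<^sub>R (\<Sum>i=1..n. Ys i \<omega>) + \<epsilon> *\<^sub>R u \<in> C}
      \<le> X.prob {\<omega> \<in> space M. (1 / real n) *\<^sub>R (\<Sum>i=1..n. Xs i \<omega>) \<in> C}"
proof -
  have add: "Modules.additive t" and tu: "t u \<ge> 0"
    using t X.unit_pos by (auto simp: X.monotone_homs_iff)
  have t_avg: "real n * t ((1 / real n) *\<^sub>R x) = t x" if "n \<ge> 1" for n x
    using that additive_scale_nat[OF add, of n "(1 / real n) *\<^sub>R x"] by simp
  \<comment> \<open>Five losses: one in the rate for \<open>X\<close>, one for the half-space
    starting at \<open>a - \<delta>\<close>, one for the shift by
    \<open>\<epsilon> *\<^sub>R u\<close>, and two to absorb the factor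
    \<open>1 / 2\<close>.\<close>
  define \<delta> where "\<delta> = (ln (X.mgf t) - ln (Y.mgf t) - k) / 5"
  have \<delta>: "\<delta> > 0" using k by (simp add: \<delta>_def)
  define \<epsilon> where "\<epsilon> = \<delta> / (t u + 1)"
  have \<epsilon>: "\<epsilon> > 0" "\<epsilon> * t u \<le> \<delta>" using \<delta> tu by (simp_all add: \<epsilon>_def field_simps)
  obtain a where a: "\<And>\<delta>. \<delta> > 0 \<Longrightarrow> \<forall>\<^sub>F n in sequentially. X.mgf t ^ n * exp (- real n * (a + \<delta>)) / 2
      \<le> X.prob {\<omega> \<in> space M. real n * (a - \<delta>) \<le> t (\<Sum>i=1..n. Xs i \<omega>)}"
    using X.cramer_lower_halfspace[OF t] by blast
  define C where "C = {x. a - \<delta> \<le> t x}"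
  have closed_C: "closed C"
    unfolding C_def by (intro closed_Collect_le continuous_intros X.monotone_hom_continuous[OF t])
  have upset_C: "upset P C"
    using t by (auto simp: upset_def C_def monotone_homs_def monotone_def intro: order_trans)
  have ev: "\<forall>\<^sub>F n in sequentially. 2 < exp (real n * (2 * \<delta>))"
    using \<delta> by real_asymp
  from ev a[OF \<delta>] eventually_ge_at_top[of 1]
  have "\<forall>\<^sub>F n in sequentially. closed C \<and> upset P C \<and>
    X.prob {\<omega> \<in> space M. (1 / real n) *\<^sub>R (\<Sum>i=1..n. Xs i \<omega>) \<in> C} > 0 \<and>
    exp (real n * k) * Y.prob {\<omega> \<in> space N. (1 / real n) *\<^sub>R (\<Sum>i=1..n. Ys i \<omega>) + \<epsilon> *\<^sub>R u \<in> C}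
      \<le> X.prob {\<omega> \<in> space M. (1 / real n) *\<^sub>R (\<Sum>i=1..n. Xs i \<omega>) \<in> C}"
  proof eventually_elim
    case (elim n)
    define p where "p = X.prob {\<omega> \<in> space M. (1 / real n) *\<^sub>R (\<Sum>i=1..n. Xs i \<omega>) \<in> C}"
    define q where "q = Y.prob {\<omega> \<in> space N. (1 / real n) *\<^sub>R (\<Sum>i=1..n. Ys i \<omega>) + \<epsilon> *\<^sub>R u \<in> C}"
    have "a - \<delta> \<le> t ((1 / real n) *\<^sub>R x) \<longleftrightarrow> real n * (a - \<delta>) \<le> t x" for x
      using t_avg[OF elim(3), of x] elim(3) mult_le_cancel_left_pos[of "real n" "a - \<delta>" "t ((1 / real n) *\<^sub>R x)"] by simp
    then have p_ge: "X.mgf t ^ n * exp (- real n * (a + \<delta>)) / 2 \<le> p"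
      using elim(2) by (simp add: p_def C_def)
    have q_le: "q \<le> Y.mgf t ^ n * exp (- (real n * (a - 2 * \<delta>)))"
      unfolding q_def
    proof (rule Y.chernoff[OF t Y.average_plus_event[OF closed_C]])
      fix \<omega> assume "\<omega> \<in> {\<omega> \<in> space N. (1 / real n) *\<^sub>R (\<Sum>i=1..n. Ys i \<omega>) + \<epsilon> *\<^sub>R u \<in> C}"
      then have "a - \<delta> \<le> t ((1 / real n) *\<^sub>R (\<Sum>i=1..n. Ys i \<omega>)) + \<epsilon> * t u"
        by (simp add: C_def additive.add[OF add] X.monotone_hom_scale_unit[OF t])
      then have "real n * (a - 2 * \<delta>) \<le> real n * t ((1 / real n) *\<^sub>R (\<Sum>i=1..n. Ys i \<omega>))"
        using \<epsilon>(2) by (intro mult_left_mono) auto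
      then show "real n * (a - 2 * \<delta>) \<le> t (\<Sum>i=1..n. Ys i \<omega>)" unfolding t_avg[OF elim(3)] .
    qed
    have pw: "X.mgf t ^ n = exp (real n * ln (X.mgf t))" "Y.mgf t ^ n = exp (real n * ln (Y.mgf t))"
      using X.mgf_pos[OF t] Y.mgf_pos[OF t] by (simp_all add: exp_of_nat_mult)
    have "exp (real n * k) * q \<le> exp (real n * k) * (Y.mgf t ^ n * exp (- (real n * (a - 2 * \<delta>))))"
      using q_le by (intro mult_left_mono) auto
    also have "\<dots> = X.mgf t ^ n * exp (- real n * (a + \<delta>)) / exp (real n * (2 * \<delta>))"
      unfolding pw by (simp add: \<delta>_def field_simps flip: exp_add exp_diff)
    also have "\<dots> \<le> X.mgf t ^ n * exp (- real n * (a + \<delta>)) / 2"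
      using elim(1) X.mgf_pos[OF t] by (intro divide_left_mono) auto
    also have "\<dots> \<le> p" by (rule p_ge)
    finally have "exp (real n * k) * q \<le> p" .
    moreover have "0 < X.mgf t ^ n * exp (- real n * (a + \<delta>)) / 2" using X.mgf_pos[OF t] by simp
    then have "p > 0" using p_ge by linarith
    ultimately show ?case using closed_C upset_C by (simp add: p_def q_def)
  qed
  then show ?thesis using \<epsilon>(1) by (intro that[of \<epsilon>]) (auto elim!: eventually_mono)
qed

text \<open>With \<open>i\<close> the Chernoff rate of \<open>X\<close> at \<open>y\<close>, the
  hypothesis makes \<open>i - r\<close> admissible for Cramer's lower bound for \<open>Y\<close>.
  The shift by \<open>4 * \<delta>\<close> consists of \<delta> for rounding in the moment
  generating function, \<open>2 * \<delta>\<close> in Cramer's bound, and \<delta> for returning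
  from rounded values to \<open>Y\<close>.\<close>

lemma orthant_ratio_upper_bound:
  assumes r: "\<And>t. t \<in> monotone_homs P \<Longrightarrow> X.mgf t \<le> exp r * Y.mgf t" and \<delta>: "\<delta> > 0"
  shows "\<forall>\<^sub>F n in sequentially. X.prob {\<omega> \<in> space M. (1 / real n) *\<^sub>R (\<Sum>i=1..n. Xs i \<omega>) - y \<in> P}
    \<le> exp (real n * (r + \<delta>)) * Y.prob {\<omega> \<in> space N. (1 / real n) *\<^sub>R (\<Sum>i=1..n. Ys i \<omega>) - (y - (4 * \<delta>) *\<^sub>R u) \<in> P}"
proof -
  define p where "p n = X.prob {\<omega> \<in> space M. (1 / real n) *\<^sub>R (\<Sum>i=1..n. Xs i \<omega>) - y \<in> P}" for n
  define q where "q n = Y.prob {\<omega> \<in> space N. (1 / real n) *\<^sub>R (\<Sum>i=1..n. Ys i \<omega>) - (y - (4 * \<delta>) *\<^sub>R u) \<in> P}" for n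
  have q_nonneg: "q n \<ge> 0" for n by (simp add: q_def)
  show ?thesis
  \<comment> \<open>The infimum \<open>i\<close> must be finite: a single positive
    \<open>p m\<close> bounds it below through Chernoff's inequality. If there is none, the claim is
    trivial.\<close>
  proof (cases "\<exists>n\<ge>1. p n > 0")
    case False
    then have "p n \<le> exp (real n * (r + \<delta>)) * q n" if "n \<ge> 1" for n
      using that q_nonneg[of n] by (meson exp_ge_zero mult_nonneg_nonneg not_less order_trans)
    then show ?thesis unfolding p_def q_def by (auto simp: eventually_sequentially)
  next
    case True
    define i where "i = (INF t\<in>monotone_homs P. ln (X.mgf t) - t y)"
    have ln_le: "ln (p n) / real n \<le> ln (X.mgf t) - t y" if "n \<ge> 1" "p n > 0" "t \<in> monotone_homs P" for n t
    proof -
      have "ln (p n) \<le> ln (exp (real n * (ln (X.mgf t) - t y)))"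
        using X.chernoff_average[OF that(3,1), of y] that(2) unfolding p_def by (subst ln_le_cancel_iff) auto
      then show ?thesis using that(1) by (simp add: field_simps)
    qed
    obtain m where m: "m \<ge> 1" "p m > 0" using True by auto
    have bdd: "bdd_below ((\<lambda>t. ln (X.mgf t) - t y) ` monotone_homs P)"
      using ln_le[OF m] by (intro bdd_belowI2)
    have p_le: "p n \<le> exp (real n * i)" if "n \<ge> 1" for n
    proof (cases "p n > 0")
      case pos: True
      have "ln (p n) / real n \<le> i"
        unfolding i_def using X.monotone_homs_zero ln_le[OF that pos] by (intro cINF_greatest) auto
      then have "ln (p n) \<le> real n * i" using that by (simp add: field_simps)
      then have "exp (ln (p n)) \<le> exp (real n * i)" by simp
      then show ?thesis using pos by simp
    next
      case False
      then show ?thesis using exp_ge_zero order_trans not_less by metis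
    qed
    obtain A g where A: "finite A" and g: "g \<in> borel \<rightarrow>\<^sub>M count_space UNIV" and gA: "range g \<subseteq> A"
      and g_close: "\<And>x. x \<in> L \<Longrightarrow> X.close \<delta> x (g x)"
      using X.discretisation[OF Y.compact_K \<delta>] by metis
    define w where "w = (\<lambda>a. Y.prob {\<omega> \<in> space N. g (Y \<omega>) = a})"
    have fw: "finite_weights A w" using Y.finite_weights_discretised[OF A g gA] by (simp add: w_def)
    have "exp (t (y - \<delta> *\<^sub>R u) + (i - r)) \<le> (\<Sum>a\<in>A. w a * exp (t a))" if t: "t \<in> monotone_homs P" for t
    proof -
      have add: "Modules.additive t" using t by (simp add: monotone_homs_def)
      have "i \<le> ln (X.mgf t) - t y" unfolding i_def by (rule cINF_lower[OF bdd t])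
      then have "exp (i + t y) \<le> exp (ln (X.mgf t))" by simp
      also have "\<dots> = X.mgf t" using X.mgf_pos[OF t] by simp
      also have "\<dots> \<le> exp r * Y.mgf t" by (rule r[OF t])
      also have "\<dots> \<le> exp r * (exp (\<delta> * t u) * (\<Sum>a\<in>A. w a * exp (t a)))"
        unfolding w_def using Y.mgf_le_discretised[OF A g gA g_close t] by (intro mult_left_mono) auto
      finally have "exp (i + t y) \<le> exp (r + \<delta> * t u) * (\<Sum>a\<in>A. w a * exp (t a))"
        by (simp add: exp_add mult_ac)
      then have "exp (- (r + \<delta> * t u)) * exp (i + t y)
          \<le> exp (- (r + \<delta> * t u)) * (exp (r + \<delta> * t u) * (\<Sum>a\<in>A. w a * exp (t a)))"
        by (intro mult_left_mono) auto
      then show ?thesis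
        by (simp add: additive.diff[OF add] X.monotone_hom_scale_unit[OF t] algebra_simps flip: mult.assoc exp_add)
    qed
    from X.eventually_tail_weight_ge[OF fw \<delta> this]
    have "\<forall>\<^sub>F n in sequentially. exp (real n * (i - r - \<delta>))
        \<le> tail_weight P A w n (real n *\<^sub>R (y - \<delta> *\<^sub>R u - (2 * \<delta>) *\<^sub>R u))" .
    then have "\<forall>\<^sub>F n in sequentially. p n \<le> exp (real n * (r + \<delta>)) * q n"
      using eventually_ge_at_top[of 1]
    proof eventually_elim
      case (elim n)
      have eq: "y - \<delta> *\<^sub>R u - (2 * \<delta>) *\<^sub>R u - \<delta> *\<^sub>R u = y - (4 * \<delta>) *\<^sub>R u"
        by (simp add: diff_diff_eq flip: scaleR_add_left)
      have "exp (real n * (i - r - \<delta>)) \<le> q n"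
        using order_trans[OF elim(1)[unfolded w_def] Y.tail_weight_le_prob_average[OF A g gA g_close elim(2)]]
        unfolding q_def eq .
      then have "exp (real n * (r + \<delta>)) * exp (real n * (i - r - \<delta>)) \<le> exp (real n * (r + \<delta>)) * q n"
        by (intro mult_left_mono) auto
      also have "exp (real n * (r + \<delta>)) * exp (real n * (i - r - \<delta>)) = exp (real n * i)"
        by (simp add: algebra_simps flip: exp_add)
      finally show ?case using p_le[OF elim(2)] by linarith
    qed
    then show ?thesis unfolding p_def q_def .
  qed
qed

text \<open>The threshold for \<open>n\<close> is chosen for the finitely many net points, so it is
  common to all \<open>C\<close>; a union bound over the net costs at most the factor
  \<open>card Z\<close>.\<close>

lemma upset_ratio_upper_bound:
  assumes r: "\<forall>t\<in>monotone_homs P. X.mgf t \<le> exp r * Y.mgf t" and \<epsilon>: "\<epsilon> > 0" and \<rho>: "\<rho> > 0"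
  shows "\<forall>\<^sub>F n in sequentially. \<forall>C. closed C \<longrightarrow> upset P C \<longrightarrow>
    X.prob {\<omega> \<in> space M. (1 / real n) *\<^sub>R (\<Sum>i=1..n. Xs i \<omega>) \<in> C}
    \<le> exp (real n * (r + \<rho>)) * Y.prob {\<omega> \<in> space N. (1 / real n) *\<^sub>R (\<Sum>i=1..n. Ys i \<omega>) + \<epsilon> *\<^sub>R u \<in> C}"
proof -
  \<comment> \<open>An orthant sits at \<open>z - \<delta> *\<^sub>R u\<close> and the comparison
    lowers it by \<open>4 * \<delta>\<close>, whereas the point known to lie in \<open>C\<close> is
    \<open>z + \<delta> *\<^sub>R u\<close>: six in total. Half of \<rho> covers \<delta> in the
    exponent, half the size of the net.\<close>
  define \<delta> where "\<delta> = min (\<epsilon> / 6) (\<rho> / 2)"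
  have \<delta>: "\<delta> > 0" "6 * \<delta> \<le> \<epsilon>" "\<delta> \<le> \<rho> / 2" using \<epsilon> \<rho> by (auto simp: \<delta>_def)
  obtain Z where Z: "finite Z"
    "\<And>n. n \<ge> 1 \<Longrightarrow> AE \<omega> in M. \<exists>z\<in>Z. X.close \<delta> ((1 / real n) *\<^sub>R (\<Sum>i=1..n. Xs i \<omega>)) z"
    using X.finite_net_of_sample_averages[OF \<delta>(1)] by blast
  have "\<forall>\<^sub>F n in sequentially. real (card Z) < exp (real n * (\<rho> / 2))"
    using \<rho> by real_asymp
  moreover have "\<forall>\<^sub>F n in sequentially. \<forall>z\<in>Z.
    X.prob {\<omega> \<in> space M. (1 / real n) *\<^sub>R (\<Sum>i=1..n. Xs i \<omega>) - (z - \<delta> *\<^sub>R u) \<in> P} \<le> exp (real n * (r + \<delta>)) *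
    Y.prob {\<omega> \<in> space N. (1 / real n) *\<^sub>R (\<Sum>i=1..n. Ys i \<omega>) - (z - \<delta> *\<^sub>R u - (4 * \<delta>) *\<^sub>R u) \<in> P}"
    by (intro eventually_ball_finite Z ballI orthant_ratio_upper_bound r[rule_format] \<delta>)
  ultimately show ?thesis
    using eventually_ge_at_top[of 1]
  proof eventually_elim
    case (elim n)
    show ?case
    proof (intro allI impI)
      fix C assume C: "closed C" "upset P C"
      let ?S = "\<lambda>\<omega>. (1 / real n) *\<^sub>R (\<Sum>i=1..n. Xs i \<omega>)" and ?T = "\<lambda>\<omega>. (1 / real n) *\<^sub>R (\<Sum>i=1..n. Ys i \<omega>)"
      define q where "q = Y.prob {\<omega> \<in> space N. ?T \<omega> + \<epsilon> *\<^sub>R u \<in> C}"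
      \<comment> \<open>An average in \<open>C\<close> that is close to \<open>z\<close> lies below
        \<open>z + \<delta> *\<^sub>R u\<close>, which then belongs to the upset as well.\<close>
      define Z' where "Z' = {z\<in>Z. z + \<delta> *\<^sub>R u \<in> C}"
      have Z': "finite Z'" "card Z' \<le> card Z" using Z(1) by (auto simp: Z'_def intro: card_mono)
      define E where "E z = {\<omega> \<in> space M. ?S \<omega> - (z - \<delta> *\<^sub>R u) \<in> P}" for z
      have E: "E z \<in> X.events" for z unfolding E_def by (rule X.average_ge_event)
      have "X.prob {\<omega> \<in> space M. ?S \<omega> \<in> C} \<le> X.prob (\<Union>z\<in>Z'. E z)"
      proof (rule X.finite_measure_mono_AE)
        show "(\<Union>z\<in>Z'. E z) \<in> X.events" using E Z' by (intro sets.finite_UN) auto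
        show "AE \<omega> in M. \<omega> \<in> {\<omega> \<in> space M. ?S \<omega> \<in> C} \<longrightarrow> \<omega> \<in> (\<Union>z\<in>Z'. E z)"
          using Z(2)[OF elim(3)]
        proof eventually_elim
          case (elim \<omega>)
          then obtain z where z: "z \<in> Z" "\<delta> *\<^sub>R u - (?S \<omega> - z) \<in> P" "\<delta> *\<^sub>R u + (?S \<omega> - z) \<in> P"
            by (auto simp: X.close_def)
          have "z + \<delta> *\<^sub>R u - ?S \<omega> \<in> P" "?S \<omega> - (z - \<delta> *\<^sub>R u) \<in> P"
            using z by (simp_all add: algebra_simps)
          then have "z \<in> Z'" if "?S \<omega> \<in> C" using that C(2) z(1)
            unfolding upset_def cone_le_def Z'_def by blast
          then show ?case using \<open>?S \<omega> - (z - \<delta> *\<^sub>R u) \<in> P\<close> by (auto simp: E_def)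
        qed
      qed
      also have "\<dots> \<le> (\<Sum>z\<in>Z'. X.prob (E z))"
        using E Z' by (intro X.finite_measure_subadditive_finite) auto
      also have "\<dots> \<le> (\<Sum>z\<in>Z'. exp (real n * (r + \<delta>)) * q)"
      proof (rule sum_mono)
        fix z assume z: "z \<in> Z'"
        have "?T \<omega> + \<epsilon> *\<^sub>R u \<in> C" if "?T \<omega> - (z - \<delta> *\<^sub>R u - (4 * \<delta>) *\<^sub>R u) \<in> P" for \<omega>
        proof -
          have "?T \<omega> - (z - \<delta> *\<^sub>R u - (4 * \<delta>) *\<^sub>R u) + (\<epsilon> - 6 * \<delta>) *\<^sub>R u \<in> P"
            using \<delta> that by (intro X.add_pos X.scale_unit_pos) auto
          also have "?T \<omega> - (z - \<delta> *\<^sub>R u - (4 * \<delta>) *\<^sub>R u) + (\<epsilon> - 6 * \<delta>) *\<^sub>R u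
              = (?T \<omega> + \<epsilon> *\<^sub>R u) - z + (\<delta> + 4 * \<delta> - 6 * \<delta>) *\<^sub>R u"
            unfolding scaleR_add_left scaleR_diff_left by simp
          also have "\<dots> = (?T \<omega> + \<epsilon> *\<^sub>R u) - (z + \<delta> *\<^sub>R u)" by simp
          finally show ?thesis using z C(2) unfolding upset_def cone_le_def Z'_def by blast
        qed
        then have "Y.prob {\<omega> \<in> space N. ?T \<omega> - (z - \<delta> *\<^sub>R u - (4 * \<delta>) *\<^sub>R u) \<in> P} \<le> q"
          unfolding q_def by (intro Y.finite_measure_mono Y.average_plus_event C) auto
        then have "exp (real n * (r + \<delta>)) * Y.prob {\<omega> \<in> space N. ?T \<omega> - (z - \<delta> *\<^sub>R u - (4 * \<delta>) *\<^sub>R u) \<in> P}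
            \<le> exp (real n * (r + \<delta>)) * q" by (intro mult_left_mono) auto
        moreover have "z \<in> Z" using z by (simp add: Z'_def)
        ultimately show "X.prob (E z) \<le> exp (real n * (r + \<delta>)) * q"
          using elim(2) unfolding E_def by (meson order_trans)
      qed
      also have "\<dots> = real (card Z') * (exp (real n * (r + \<delta>)) * q)" by simp
      also have "\<dots> \<le> exp (real n * (\<rho> / 2)) * (exp (real n * (r + \<delta>)) * q)"
        using elim(1) Z'(2) by (intro mult_right_mono) (auto simp: q_def)
      also have "\<dots> = exp (real n * (\<rho> / 2 + r + \<delta>)) * q"
        by (simp add: algebra_simps exp_add)
      also have "\<dots> \<le> exp (real n * (r + \<rho>)) * q"
        using \<delta>(3) by (intro mult_right_mono) (auto simp: q_def intro!: mult_left_mono)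
      finally show "X.prob {\<omega> \<in> space M. ?S \<omega> \<in> C} \<le> exp (real n * (r + \<rho>)) * q" .
    qed
  qed
qed

end

section \<open>From probability estimates to the identity of suprema\<close>

lemma ordered_iid_sampleI:
  fixes P :: "'v::real_tvs set"
  assumes P: "convex_cone P" "closed P" "u \<in> P" "0 \<in> interior (cone_interval P (- u) u)"
    and M: "prob_space M" and X: "radon_rv M X" "compactly_supported M X" "iid_copies M X Xs"
  shows "ordered_iid_sample P u M X Xs (measure_support (distr M borel X))"
proof -
  interpret prob_space M by (rule M)
  show ?thesis
  proof
    show "\<exists>c. c *\<^sub>R u - x \<in> P" for x by (rule order_unit_of_interior[OF P(1,4)])
    show "AE \<omega> in M. X \<omega> \<in> measure_support (distr M borel X)"
      by (rule AE_in_measure_support[OF X(1)])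
    show "(\<lambda>\<omega>. \<Sum>i=1..n. Xs i \<omega>) \<in> borel_measurable M" for n
      by (rule iid_copies_sum_measurable[OF X(3)])
  qed (use P X in \<open>auto simp: radon_rv_def compactly_supported_def iid_copies_def\<close>)
qed

theorem theorem7p1:
  fixes V\<^sub>p :: "'v::real_tvs set" and u :: 'v
    and M :: "'a measure" and X :: "'a \<Rightarrow> 'v" and Xs :: "nat \<Rightarrow> 'a \<Rightarrow> 'v"
    and N :: "'b measure" and Y :: "'b \<Rightarrow> 'v" and Ys :: "nat \<Rightarrow> 'b \<Rightarrow> 'v"
  assumes "convex_cone V\<^sub>p" and "closed V\<^sub>p"
    and "u \<in> V\<^sub>p" and "0 \<in> interior (cone_interval V\<^sub>p (- u) u)"
    and "prob_space M" and "radon_rv M X" and "compactly_supported M X" and "iid_copies M X Xs"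
    and "prob_space N" and "radon_rv N Y" and "compactly_supported N Y" and "iid_copies N Y Ys"
  shows
    "(SUP \<epsilon>\<in>{0<..}. liminf (\<lambda>n. SUP C\<in>{C. closed C \<and> upset V\<^sub>p C}. ereal (1 / real n) *
        log_ratio (measure M {\<omega> \<in> space M. (1 / real n) *\<^sub>R (\<Sum>i=1..n. Xs i \<omega>) \<in> C})
                  (measure N {\<omega> \<in> space N. (1 / real n) *\<^sub>R (\<Sum>i=1..n. Ys i \<omega>) + \<epsilon> *\<^sub>R u \<in> C})))
     = (SUP t\<in>monotone_homs V\<^sub>p.
         log_ratio (integral\<^sup>L M (\<lambda>\<omega>. exp (t (X \<omega>)))) (integral\<^sup>L N (\<lambda>\<omega>. exp (t (Y \<omega>)))))
   \<and>
     (SUP \<epsilon>\<in>{0<..}. limsup (\<lambda>n. SUP C\<in>{C. closed C \<and> upset V\<^sub>p C}. ereal (1 / real n) *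
        log_ratio (measure M {\<omega> \<in> space M. (1 / real n) *\<^sub>R (\<Sum>i=1..n. Xs i \<omega>) \<in> C})
                  (measure N {\<omega> \<in> space N. (1 / real n) *\<^sub>R (\<Sum>i=1..n. Ys i \<omega>) + \<epsilon> *\<^sub>R u \<in> C})))
     = (SUP t\<in>monotone_homs V\<^sub>p.
         log_ratio (integral\<^sup>L M (\<lambda>\<omega>. exp (t (X \<omega>)))) (integral\<^sup>L N (\<lambda>\<omega>. exp (t (Y \<omega>)))))"
proof -
  interpret S: two_ordered_samples V\<^sub>p u M X Xs "measure_support (distr M borel X)"
      N Y Ys "measure_support (distr N borel Y)"
    unfolding two_ordered_samples_def using assms by (intro conjI ordered_iid_sampleI)
  define F where "F \<epsilon> n = (SUP C\<in>{C. closed C \<and> upset V\<^sub>p C}. ereal (1 / real n) *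
        log_ratio (measure M {\<omega> \<in> space M. (1 / real n) *\<^sub>R (\<Sum>i=1..n. Xs i \<omega>) \<in> C})
                  (measure N {\<omega> \<in> space N. (1 / real n) *\<^sub>R (\<Sum>i=1..n. Ys i \<omega>) + \<epsilon> *\<^sub>R u \<in> C}))" for \<epsilon> n
  define R where "R = (SUP t\<in>monotone_homs V\<^sub>p. log_ratio (S.X.mgf t) (S.Y.mgf t))"
  have log_mgf: "log_ratio (S.X.mgf t) (S.Y.mgf t) = ereal (ln (S.X.mgf t) - ln (S.Y.mgf t))"
    if "t \<in> monotone_homs V\<^sub>p" for t
    by (rule log_ratio_pos[OF S.X.mgf_pos[OF that] S.Y.mgf_pos[OF that]])
  have liminf_le_limsup: "(SUP \<epsilon>\<in>{0<..}. liminf (F \<epsilon>)) \<le> (SUP \<epsilon>\<in>{0<..}. limsup (F \<epsilon>))"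
    by (intro SUP_mono' Liminf_le_Limsup) auto
  have lower: "R \<le> (SUP \<epsilon>\<in>{0<..}. liminf (F \<epsilon>))"
    unfolding R_def
  proof (rule SUP_least)
    fix t assume t: "t \<in> monotone_homs V\<^sub>p"
    define x where "x = ln (S.X.mgf t) - ln (S.Y.mgf t)"
    have "ereal k \<le> (SUP \<epsilon>\<in>{0<..}. liminf (F \<epsilon>))" if k: "k < x" for k
    proof -
      obtain \<epsilon> where \<epsilon>: "\<epsilon> > 0" and ev: "\<forall>\<^sub>F n in sequentially. \<exists>C. closed C \<and> upset V\<^sub>p C \<and>
          measure M {\<omega> \<in> space M. (1 / real n) *\<^sub>R (\<Sum>i=1..n. Xs i \<omega>) \<in> C} > 0 \<and>
          exp (real n * k) * measure N {\<omega> \<in> space N. (1 / real n) *\<^sub>R (\<Sum>i=1..n. Ys i \<omega>) + \<epsilon> *\<^sub>R u \<in> C}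
            \<le> measure M {\<omega> \<in> space M. (1 / real n) *\<^sub>R (\<Sum>i=1..n. Xs i \<omega>) \<in> C}"
        by (rule S.upset_ratio_lower_bound[OF t k[unfolded x_def]])
      have "ereal k \<le> liminf (F \<epsilon>)"
      proof (rule Liminf_bounded)
        show "\<forall>\<^sub>F n in sequentially. ereal k \<le> F \<epsilon> n"
          using ev eventually_ge_at_top[of 1]
        proof eventually_elim
          case (elim n)
          then obtain C where C: "closed C" "upset V\<^sub>p C"
            "measure M {\<omega> \<in> space M. (1 / real n) *\<^sub>R (\<Sum>i=1..n. Xs i \<omega>) \<in> C} > 0"
            "exp (real n * k) * measure N {\<omega> \<in> space N. (1 / real n) *\<^sub>R (\<Sum>i=1..n. Ys i \<omega>) + \<epsilon> *\<^sub>R u \<in> C}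
              \<le> measure M {\<omega> \<in> space M. (1 / real n) *\<^sub>R (\<Sum>i=1..n. Xs i \<omega>) \<in> C}" by blast
          show ?case
            unfolding F_def using C elim(2) by (intro SUP_upper2[of C] scaled_log_ratio_ge) auto
        qed
      qed
      then show ?thesis using \<epsilon> by (intro SUP_upper2[of \<epsilon>]) auto
    qed
    then have "ereal (x - e) \<le> (SUP \<epsilon>\<in>{0<..}. liminf (F \<epsilon>))" if "e > 0" for e
      using that by simp
    then have "ereal x \<le> (SUP \<epsilon>\<in>{0<..}. liminf (F \<epsilon>)) + ereal e" if "e > 0" for e
      using that by (cases "SUP \<epsilon>\<in>{0<..}. liminf (F \<epsilon>)") (fastforce simp: algebra_simps)+
    then have "ereal x \<le> (SUP \<epsilon>\<in>{0<..}. liminf (F \<epsilon>))"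
      by (rule ereal_le_epsilon2)
    then show "log_ratio (S.X.mgf t) (S.Y.mgf t) \<le> (SUP \<epsilon>\<in>{0<..}. liminf (F \<epsilon>))"
      by (simp add: log_mgf[OF t] x_def)
  qed
  have upper: "(SUP \<epsilon>\<in>{0<..}. limsup (F \<epsilon>)) \<le> R"
  proof (cases "R = \<infinity>")
    case False
    have "log_ratio (S.X.mgf (\<lambda>_. 0)) (S.Y.mgf (\<lambda>_. 0)) \<le> R"
      unfolding R_def by (rule SUP_upper[OF S.X.monotone_homs_zero])
    \<comment> \<open>The functional \<open>t = 0\<close> contributes a real number to the supremum,
      so \<open>R\<close> is real and can serve as the exponent \<open>r\<close>.\<close>
    then have "R \<noteq> - \<infinity>" using log_mgf[OF S.X.monotone_homs_zero] by auto
    then obtain r where r: "R = ereal r" using False by (cases R) auto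
    have mgf_le: "\<forall>t\<in>monotone_homs V\<^sub>p. S.X.mgf t \<le> exp r * S.Y.mgf t"
    proof
      fix t assume t: "t \<in> monotone_homs V\<^sub>p"
      have "log_ratio (S.X.mgf t) (S.Y.mgf t) \<le> R" unfolding R_def by (rule SUP_upper[OF t])
      then have "ln (S.X.mgf t) \<le> r + ln (S.Y.mgf t)" by (simp add: log_mgf[OF t] r)
      then have "exp (ln (S.X.mgf t)) \<le> exp (r + ln (S.Y.mgf t))" by simp
      then show "S.X.mgf t \<le> exp r * S.Y.mgf t"
        using S.X.mgf_pos[OF t] S.Y.mgf_pos[OF t] by (simp add: exp_add)
    qed
    show ?thesis
    proof (rule SUP_least)
      fix \<epsilon> :: real assume "\<epsilon> \<in> {0<..}"
      then have \<epsilon>: "\<epsilon> > 0" by simp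
      show "limsup (F \<epsilon>) \<le> R"
      proof (rule ereal_le_epsilon2)
        fix \<rho> :: real assume \<rho>: "\<rho> > 0"
        have "limsup (F \<epsilon>) \<le> ereal (r + \<rho>)"
        proof (rule Limsup_bounded)
          show "\<forall>\<^sub>F n in sequentially. F \<epsilon> n \<le> ereal (r + \<rho>)"
            using S.upset_ratio_upper_bound[OF mgf_le \<epsilon> \<rho>] eventually_ge_at_top[of 1]
          proof eventually_elim
            case (elim n)
            then show ?case unfolding F_def by (intro SUP_least scaled_log_ratio_le) auto
          qed
        qed
        then show "limsup (F \<epsilon>) \<le> R + ereal \<rho>" by (simp add: r)
      qed
    qed
  qed simp
  have "(SUP \<epsilon>\<in>{0<..}. liminf (F \<epsilon>)) = R \<and> (SUP \<epsilon>\<in>{0<..}. limsup (F \<epsilon>)) = R"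
    \<comment> \<open>Both versions follow at once from the chain \<open>R \<le>\<close> liminf
      version \<open>\<le>\<close> limsup version \<open>\<le> R\<close>.\<close>
    using liminf_le_limsup lower upper by (auto intro!: antisym intro: order_trans)
  then show ?thesis unfolding F_def R_def S.X.mgf_def S.Y.mgf_def .
qed

end
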